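(* There is a low-degree univariate polynomial $P$ (independent of the input polynomial $p$) such that the following holds. Let $A=F+uv^*$ be the colleague linearization of a degree $n$ polynomial $p(x)=\sum_{i=0}^np_iT_i(x)$ expressed in the Chebyshev basis, and let $T$ be its approximate Schur form computed in floating point arithmetic with unit roundoff $\epsilon_m$ by the structured QR iteration described in the context. Then there exist a unitary matrix $Q$ and a matrix $\delta A$ such that $$T=Q^*(A+\delta A)Q,\qquad \|\delta A\|\le P(n)\,\|A\|\,\epsilon_m .$$
   Context: **Conventions.** $\|\cdot\|$ is the spectral norm for matrices and the Euclidean norm for vectors; $T_i$ are the Chebyshev polynomials of the first kind. Floating point arithmetic follows the standard model $\mathrm{fl}(a\circ b)=(a\circ b)(1+\delta)$, $|\delta|\le\epsilon_m$, with $\epsilon_m$ the unit roundoff; as usual in backward error analysis, bounds are to first order in $\epsilon_m$. It is a standing assumption that the QR iteration converges in a number of sweeps bounded by a constant multiple of $n$ (so the total number of Givens rotations is polynomial in $n$). **Colleague matrix.** For $p=\sum_{i=0}^n p_iT_i$, $p_n\ne0$, the colleague matrix is $F+uv^*$ where $F=F^*$ is the $n\times n$ symmetric tridiagonal matrix with zero diagonal and off-diagonal entries $F_{i,i+1}=F_{i+1,i}=\frac12$ for $1\le i\le n-2$, $F_{n-1,n}=F_{n,n-1}=\frac{\sqrt2}{2}$; $u=e_1$; and $v^*=-\frac1{2p_n}\,[\,p_{n-1},\,p_{n-2},\dots,p_1,\,\sqrt2\,p_0\,]$. It is upper Hessenberg and its eigenvalues are the roots of $p$. **Generator representation.** An upper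 Hessenberg matrix $A=F+uv^*$ with $F=F^*$ is stored by four vectors (generators) $d\in\mathbb C^n$, $\beta\in\mathbb C^{n-1}$, $u,v\in\mathbb C^n$, where $d_i=A_{ii}$, $\beta_i=A_{i+1,i}$. Entries above the diagonal are never stored; they are recovered by Hermitian symmetry of $F$: for $i<j$, $A_{ij}=\overline{A_{ji}}-\overline{u_j}v_i+u_i\overline{v_j}$ (so $A_{i,i+1}=\overline{\beta_i}-\overline{u_{i+1}}v_i+u_i\overline{v_{i+1}}$, and $A_{ij}=u_i\overline{v_j}-\overline{u_j}v_i$ when $j>i+1$ and $A_{ji}=0$). During a sweep the few nonzero entries below the subdiagonal (the "bulge") are stored explicitly as well. **Structured QR iteration.** It is the implicit QR iteration (bulge chasing), carried out in floating point only on the generators. *Single shift* ($\sigma$): compute a Givens rotation $G_1$ on indices $(1,2)$ with $G_1^*(A-\sigma I)e_1$ a multiple of $e_1$; replace $A$ by $G_1^*AG_1$; then for $i=2,\dots,n-1$ compute a Givens rotation $G_i$ on indices $(i,i+1)$ which annihilates the bulge entry $(i+1,i-1)$ against $\beta_{i-1}$, and replace $A$ by $G_i^*AG_i$. Each replacement is performed by (a) forming the $3\times2$ block $A_{i:i+2,\,i:i+1}$ from the generators, its entry $A_{i,i+1}$ being recovered by the symmetry formula, multiplying it on the left by $\mathrm{diag}(\hat G_i^*,1)$ and on the right by $\hat G_i$ (with $\hat G_i$ the active $2\times 2$ block), and reading off the new $d_i,d_{i+1},\beta_i,\beta_{i+1}$ and bulge; (b) updating $\beta_{i-1}$ to the norm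 of $(\beta_{i-1},\text{bulge})$; (c) replacing $u\gets G_i^*u$, $v\gets G_i^*v$. *Double shift* (real matrices, shift polynomial $\rho(z)=z^2-2\Re(\sigma)z+|\sigma|^2$): the same, with each $G_i$ replaced by a product of two Givens rotations acting on three consecutive indices $i,i+1,i+2$ (the first one chosen so that $\rho(A)e_1$ is mapped to a multiple of $e_1$, the following ones so as to annihilate the two bulge entries in column $i-1$), with the $4\times3$ block $A_{i:i+3,\,i:i+2}$ formed from generators, bulge and symmetry formula in place of the $3\times2$ block. *Deflation*: subdiagonal entries that are negligible at the level of the unit roundoff are set to zero and the problem is split. *Aggressive early deflation* (optional): the Schur form $Q^*A_{22}Q$ of a small trailing $k\times k$ block is computed by the same generator-based rotations; with $x$ the vector obtained by applying $Q^*$ to $\beta_{n-k}e_1$, trailing entries of $x$ with modulus at most $\epsilon_m\min\{|\beta_{n-k}|,|t|\}$ ($t$ the corresponding diagonal entry of the Schur form) are set to zero and those eigenvalues deflated; the remaining trailing block is reduced back to Hessenberg form by Givens similarities $A\gets G^*AG$ performed on the generators (the entries of $x$ are annihilated one at a time starting from the bottom, each time chasing the resulting bulge to the bottom; for each rotation $G$, acting on two consecutive indices, the small block of $A$ around the diagonal affected by $G$ is formed from the generators, the bulge and the symmetry formula, multiplied on the left by the active part of $G^*$ and on the right by that of $G$, the new entries of $d$, $\beta$ and the bulge are read off, $x$ is updated by $G^*$, and $u\gets G^*u$, $v\gets G^*v$), and its eigenvalues are used as shifts. Several bulges may be chased concurrently. The process ends when the matrix is (block) triangular (with $2\times2$ diagonal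 blocks possible in the double-shift case); this is the computed Schur form $T$, and its eigenvalues are the computed eigenvalues. *)

theory Defs
  imports
    Complex_Main
    "HOL-Computational_Algebra.Polynomial"
    "Jordan_Normal_Form.Schur_Decomposition"
begin

text \<open>All indices start at 0, so index \<open>i\<close> here is index \<open>i + 1\<close> of the usual
  matrix notation. The size \<open>n\<close> varies inside the final statement, so matrices live
  in \<open>carrier_mat n n\<close>.\<close>

section \<open>Norms and unitary matrices\<close>

definition euclid_norm :: "complex vec \<Rightarrow> real" where
  "euclid_norm x = sqrt (\<Sum>i<dim_vec x. (cmod (x $ i))\<^sup>2)"

definition spectral_norm :: "complex mat \<Rightarrow> real" where
  "spectral_norm A =
     Sup {euclid_norm (A *\<^sub>v x) | x. x \<in> carrier_vec (dim_col A) \<and> euclid_norm x \<le> 1}"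

definition unitary :: "nat \<Rightarrow> complex mat \<Rightarrow> bool" where
  "unitary n Q \<longleftrightarrow> Q \<in> carrier_mat n n \<and> mat_adjoint Q * Q = 1\<^sub>m n"

section \<open>Chebyshev polynomials and the colleague matrix\<close>

fun cheb_poly :: "nat \<Rightarrow> complex poly" where
  "cheb_poly 0 = 1"
| "cheb_poly (Suc 0) = [:0, 1:]"
| "cheb_poly (Suc (Suc k)) = [:0, 2:] * cheb_poly (Suc k) - cheb_poly k"

definition colleague_F :: "nat \<Rightarrow> complex mat" where
  "colleague_F n = mat n n (\<lambda>(i, j).
     if i = Suc j \<or> j = Suc i
     then (if max i j = n - 1 then complex_of_real (sqrt 2 / 2) else 1 / 2)
     else 0)"

definition colleague_u :: "nat \<Rightarrow> complex vec" where
  "colleague_u n = unit_vec n 0"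

text \<open>\<open>c i\<close> is the coefficient of the \<open>i\<close>-th Chebyshev polynomial; the row vector given
  by the formula is \<open>v\<^sup>*\<close>, hence the conjugation.\<close>
definition colleague_v :: "nat \<Rightarrow> (nat \<Rightarrow> complex) \<Rightarrow> complex vec" where
  "colleague_v n c = vec n (\<lambda>j. cnj (- 1 / (2 * c n) *
     (if j = n - 1 then complex_of_real (sqrt 2) * c 0 else c (n - 1 - j))))"

definition colleague :: "nat \<Rightarrow> (nat \<Rightarrow> complex) \<Rightarrow> complex mat" where
  "colleague n c = colleague_F n +
     mat n n (\<lambda>(i, j). colleague_u n $ i * cnj (colleague_v n c $ j))"

section \<open>Floating point arithmetic\<close>

record fp =
  fadd :: "complex \<Rightarrow> complex \<Rightarrow> complex"
  fsub :: "complex \<Rightarrow> complex \<Rightarrow> complex"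
  fmul :: "complex \<Rightarrow> complex \<Rightarrow> complex"
  fdiv :: "complex \<Rightarrow> complex \<Rightarrow> complex"
  fsqrt :: "real \<Rightarrow> real"

text \<open>For real operands the relative error is real and at most the unit roundoff \<open>eps\<close>.
  For complex operands it is at most \<open>mu * eps\<close>: the choice \<open>mu = 1\<close> is the standard
  model read verbatim for complex numbers, while a modest larger constant accounts for
  complex operations that are implemented by several real ones.\<close>
definition rounded :: "real \<Rightarrow> real \<Rightarrow> complex \<Rightarrow> complex \<Rightarrow> complex \<Rightarrow> complex \<Rightarrow> bool" where
  "rounded mu eps a b z y \<longleftrightarrow>
     (\<exists>\<delta>. cmod \<delta> \<le> mu * eps \<and> y = z * (1 + \<delta>)) \<and>
     (a \<in> \<real> \<and> b \<in> \<real> \<longrightarrow> (\<exists>\<delta>::real. \<bar>\<delta>\<bar> \<le> eps \<and> y = z * (1 + complex_of_real \<delta>)))"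

definition standard_model :: "real \<Rightarrow> real \<Rightarrow> fp \<Rightarrow> bool" where
  "standard_model mu eps fl \<longleftrightarrow>
     (\<forall>a b. rounded mu eps a b (a + b) (fadd fl a b)) \<and>
     (\<forall>a b. rounded mu eps a b (a - b) (fsub fl a b)) \<and>
     (\<forall>a b. rounded mu eps a b (a * b) (fmul fl a b)) \<and>
     (\<forall>a b. b \<noteq> 0 \<longrightarrow> rounded mu eps a b (a / b) (fdiv fl a b)) \<and>
     (\<forall>x\<ge>0. \<exists>\<delta>. \<bar>\<delta>\<bar> \<le> eps \<and> fsqrt fl x = sqrt x * (1 + \<delta>))"

definition fabs2 :: "fp \<Rightarrow> complex \<Rightarrow> complex" where
  "fabs2 fl z = fadd fl (fmul fl (complex_of_real (Re z)) (complex_of_real (Re z)))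
                        (fmul fl (complex_of_real (Im z)) (complex_of_real (Im z)))"

section \<open>Generator representation\<close>

text \<open>\<open>gbulge g i j\<close> (used for \<open>i > j + 1\<close> only) holds the explicitly stored entries
  below the subdiagonal: bulges and, during aggressive early deflation, the spike.\<close>
record gens =
  gd :: "nat \<Rightarrow> complex"
  gb :: "nat \<Rightarrow> complex"
  gbulge :: "nat \<Rightarrow> nat \<Rightarrow> complex"
  gu :: "nat \<Rightarrow> complex"
  gv :: "nat \<Rightarrow> complex"

definition lower :: "gens \<Rightarrow> nat \<Rightarrow> nat \<Rightarrow> complex" where
  "lower g i j =
     (if i = j then gd g i else if i = Suc j then gb g j else if Suc j < i then gbulge g i j else 0)"

definition set_lower :: "(nat \<Rightarrow> nat \<Rightarrow> complex) \<Rightarrow> gens \<Rightarrow> gens" where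
  "set_lower M g = g\<lparr>gd := (\<lambda>i. M i i), gb := (\<lambda>i. M (Suc i) i),
     gbulge := (\<lambda>i j. if Suc j < i then M i j else 0)\<rparr>"

definition entry :: "gens \<Rightarrow> nat \<Rightarrow> nat \<Rightarrow> complex" where
  "entry g i j = (if j \<le> i then lower g i j
     else cnj (lower g j i) - cnj (gu g j) * gv g i + gu g i * cnj (gv g j))"

definition fentry :: "fp \<Rightarrow> gens \<Rightarrow> nat \<Rightarrow> nat \<Rightarrow> complex" where
  "fentry fl g i j = (if j \<le> i then lower g i j
     else fadd fl (fsub fl (cnj (lower g j i)) (fmul fl (cnj (gu g j)) (gv g i)))
                  (fmul fl (gu g i) (cnj (gv g j))))"

definition gmat :: "nat \<Rightarrow> gens \<Rightarrow> complex mat" where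
  "gmat n g = mat n n (\<lambda>(i, j). entry g i j)"

definition fgmat :: "fp \<Rightarrow> nat \<Rightarrow> gens \<Rightarrow> complex mat" where
  "fgmat fl n g = mat n n (\<lambda>(i, j). fentry fl g i j)"

definition colleague_gens :: "fp \<Rightarrow> nat \<Rightarrow> (nat \<Rightarrow> complex) \<Rightarrow> gens" where
  "colleague_gens fl n c =
     (let v = (\<lambda>j. if j = n - 1
                 then cnj (fdiv fl (- fmul fl (complex_of_real (fsqrt fl 2)) (c 0)) (fmul fl 2 (c n)))
                 else if j < n - 1 then cnj (fdiv fl (- c (n - 1 - j)) (fmul fl 2 (c n)))
                 else 0)
      in \<lparr>gd = (\<lambda>i. if i = 0 then cnj (v 0) else 0),
          gb = (\<lambda>i. if Suc i = n - 1 then fdiv fl (complex_of_real (fsqrt fl 2)) 2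
                    else if Suc i < n - 1 then 1 / 2 else 0),
          gbulge = (\<lambda>_ _. 0),
          gu = (\<lambda>i. if i = 0 then 1 else 0),
          gv = v\<rparr>)"

section \<open>Givens rotations acting on the generators\<close>

text \<open>\<open>(k, c, s)\<close> is the rotation on indices \<open>k, k + 1\<close> with active block
  \<open>G = [[c, - cnj s], [s, cnj c]]\<close>. With \<open>c = a / r\<close>, \<open>s = b / r\<close> and \<open>r\<close> the norm of
  \<open>(a, b)\<close> one has \<open>G\<^sup>* (a, b) = (r, 0)\<close>.\<close>
type_synonym rot = "nat \<times> complex \<times> complex"

definition givens_norm :: "fp \<Rightarrow> complex \<Rightarrow> complex \<Rightarrow> complex" where
  "givens_norm fl a b = complex_of_real (fsqrt fl (Re (fadd fl (fabs2 fl a) (fabs2 fl b))))"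

definition givens :: "fp \<Rightarrow> nat \<Rightarrow> complex \<Rightarrow> complex \<Rightarrow> rot" where
  "givens fl k a b =
     (if a = 0 \<and> b = 0 then (k, 1, 0)
      else (k, fdiv fl a (givens_norm fl a b), fdiv fl b (givens_norm fl a b)))"

fun vec_rot :: "fp \<Rightarrow> rot \<Rightarrow> (nat \<Rightarrow> complex) \<Rightarrow> nat \<Rightarrow> complex" where
  "vec_rot fl (k, c, s) x i =
     (if i = k then fadd fl (fmul fl (cnj c) (x k)) (fmul fl (cnj s) (x (Suc k)))
      else if i = Suc k then fsub fl (fmul fl c (x (Suc k))) (fmul fl s (x k))
      else x i)"

definition row_rot :: "fp \<Rightarrow> rot \<Rightarrow> (nat \<Rightarrow> nat \<Rightarrow> complex) \<Rightarrow> nat \<Rightarrow> nat \<Rightarrow> complex" where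
  "row_rot fl G M = (\<lambda>i j. vec_rot fl G (\<lambda>k. M k j) i)"

fun col_rot :: "fp \<Rightarrow> rot \<Rightarrow> (nat \<Rightarrow> nat \<Rightarrow> complex) \<Rightarrow> nat \<Rightarrow> nat \<Rightarrow> complex" where
  "col_rot fl (k, c, s) M i j =
     (if j = k then fadd fl (fmul fl (M i k) c) (fmul fl (M i (Suc k)) s)
      else if j = Suc k then fsub fl (fmul fl (M i (Suc k)) (cnj c)) (fmul fl (M i k) (cnj s))
      else M i j)"

text \<open>One replacement of \<open>A\<close> by \<open>G\<^sup>* A G\<close>, where \<open>G\<close> is the product of the rotations in the
  list (one for a single shift, two for a double shift). If these act on the indices
  \<open>i, \<dots>, i + m\<close>, then reading off the lower triangular part only involves the rows
  \<open>i, \<dots>, i + m\<close> to the left of the diagonal block, the columns \<open>i, \<dots>, i + m\<close> below it,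
  and the square block itself, which is where the entries recovered from the symmetry
  formula come in. As rounded operations map zeros to zero, all these entries vanish
  before and after the update except for those in the \<open>3 \<times> 2\<close> (or \<open>4 \<times> 3\<close>) block, in the
  column left of it (overwritten below), and in the spike \<open>x\<close> of an aggressive early
  deflation, which thereby is updated by \<open>G\<^sup>*\<close>.\<close>
definition similarity :: "fp \<Rightarrow> rot list \<Rightarrow> gens \<Rightarrow> gens" where
  "similarity fl Gs g =
     (set_lower (fold (col_rot fl) Gs (fold (row_rot fl) Gs (fentry fl g))) g)
       \<lparr>gu := fold (vec_rot fl) Gs (gu g), gv := fold (vec_rot fl) Gs (gv g)\<rparr>"

text \<open>Rotation on rows \<open>i - 1, i\<close> that annihilates entry \<open>(i, j)\<close> against \<open>(i - 1, j)\<close>.\<close>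
definition annihilate :: "fp \<Rightarrow> nat \<times> nat \<Rightarrow> gens \<Rightarrow> gens" where
  "annihilate fl = (\<lambda>(i, j) g.
     let a = lower g (i - 1) j; b = lower g i j;
         g' = similarity fl [givens fl (i - 1) a b] g
     in set_lower (\<lambda>k l. if l = j \<and> k = i - 1 then givens_norm fl a b
                         else if l = j \<and> k = i then 0 else lower g' k l) g')"

section \<open>Sweeps\<close>

datatype shift_mode = Single_Shift | Double_Shift

definition single_start :: "fp \<Rightarrow> complex \<Rightarrow> nat \<Rightarrow> gens \<Rightarrow> gens" where
  "single_start fl \<sigma> lo g = similarity fl [givens fl lo (fsub fl (gd g lo) \<sigma>) (gb g lo)] g"

definition single_chase :: "fp \<Rightarrow> nat \<Rightarrow> gens \<Rightarrow> gens" where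
  "single_chase fl i = annihilate fl (Suc i, i - 1)"

text \<open>Two rotations mapping \<open>(x0, x1, x2)\<close> at indices \<open>k, k + 1, k + 2\<close> to a multiple of the
  first unit vector, and the resulting norm.\<close>
definition givens3 :: "fp \<Rightarrow> nat \<Rightarrow> complex \<Rightarrow> complex \<Rightarrow> complex \<Rightarrow> rot list" where
  "givens3 fl k x0 x1 x2 = [givens fl (Suc k) x1 x2, givens fl k x0 (givens_norm fl x1 x2)]"

definition givens3_norm :: "fp \<Rightarrow> complex \<Rightarrow> complex \<Rightarrow> complex \<Rightarrow> complex" where
  "givens3_norm fl x0 x1 x2 = givens_norm fl x0 (givens_norm fl x1 x2)"

text \<open>\<open>x0, x1, x2\<close> are the nonzero entries of the first column of
  \<open>A\<^sup>2 - 2 Re \<sigma> A + |\<sigma>|\<^sup>2 I\<close> for the Hessenberg block starting at \<open>lo\<close>.\<close>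
definition double_start :: "fp \<Rightarrow> complex \<Rightarrow> nat \<Rightarrow> gens \<Rightarrow> gens" where
  "double_start fl \<sigma> lo g =
     (let t = fmul fl 2 (complex_of_real (Re \<sigma>)); p = fabs2 fl \<sigma>;
          d0 = gd g lo; d1 = gd g (Suc lo); b0 = gb g lo; b1 = gb g (Suc lo);
          a01 = fentry fl g lo (Suc lo);
          x0 = fadd fl (fsub fl (fadd fl (fmul fl d0 d0) (fmul fl a01 b0)) (fmul fl t d0)) p;
          x1 = fmul fl b0 (fsub fl (fadd fl d0 d1) t);
          x2 = fmul fl b0 b1
      in similarity fl (givens3 fl lo x0 x1 x2) g)"

definition double_chase :: "fp \<Rightarrow> nat \<Rightarrow> gens \<Rightarrow> gens" where
  "double_chase fl i g =
     (let j = i - 1; x0 = lower g i j; x1 = lower g (i + 1) j; x2 = lower g (i + 2) j;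
          g' = similarity fl (givens3 fl i x0 x1 x2) g
      in set_lower (\<lambda>k l. if l = j \<and> k = i then givens3_norm fl x0 x1 x2
                          else if l = j \<and> (k = i + 1 \<or> k = i + 2) then 0
                          else lower g' k l) g')"

text \<open>The successive updates of one sweep on the diagonal block with indices
  \<open>lo, \<dots>, hi\<close>. A double shift sweep ends with a single rotation on the last two indices.\<close>
fun sweep :: "shift_mode \<Rightarrow> fp \<Rightarrow> complex \<times> nat \<times> nat \<Rightarrow> (gens \<Rightarrow> gens) list" where
  "sweep Single_Shift fl (\<sigma>, lo, hi) =
     single_start fl \<sigma> lo # map (single_chase fl) [lo + 1..<hi]"
| "sweep Double_Shift fl (\<sigma>, lo, hi) =
     double_start fl \<sigma> lo # map (double_chase fl) [lo + 1..<hi - 1] @ [single_chase fl (hi - 1)]"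

fun interleavings :: "'a list list \<Rightarrow> 'a list set" where
  "interleavings [] = {[]}"
| "interleavings (xs # xss) = (\<Union>ys\<in>interleavings xss. shuffles xs ys)"

text \<open>A diagonal block of the part \<open>a, \<dots>, b\<close> of the matrix that is split off by zero
  subdiagonal entries.\<close>
definition split_block :: "nat \<Rightarrow> nat \<Rightarrow> gens \<Rightarrow> nat \<Rightarrow> nat \<Rightarrow> bool" where
  "split_block a b g lo hi \<longleftrightarrow> a \<le> lo \<and> lo \<le> hi \<and> hi \<le> b \<and>
     (lo = a \<or> gb g (lo - 1) = 0) \<and> (hi = b \<or> gb g hi = 0)"

fun sweepable :: "shift_mode \<Rightarrow> nat \<Rightarrow> nat \<Rightarrow> bool" where
  "sweepable Single_Shift lo hi \<longleftrightarrow> lo + 1 \<le> hi"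
| "sweepable Double_Shift lo hi \<longleftrightarrow> lo + 2 \<le> hi"

text \<open>\<open>m\<close> sweeps, with arbitrary shifts. For \<open>m > 1\<close> their updates may be interleaved in any
  way; this comprises all schedules in which several bulges are chased concurrently.\<close>
definition sweep_batch ::
  "shift_mode \<Rightarrow> fp \<Rightarrow> nat \<Rightarrow> nat \<Rightarrow> nat \<Rightarrow> gens \<Rightarrow> gens \<Rightarrow> bool" where
  "sweep_batch mode fl a b m g g' \<longleftrightarrow>
     (\<exists>ss ops. length ss = m \<and> 0 < m \<and>
        (\<forall>(\<sigma>, lo, hi)\<in>set ss. split_block a b g lo hi \<and> sweepable mode lo hi) \<and>
        ops \<in> interleavings (map (sweep mode fl) ss) \<and> g' = fold (\<lambda>f. f) ops g)"

section \<open>Deflation\<close>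

text \<open>\<open>theta\<close> is the constant of the deflation criterion. The customary local criterion
  \<open>|\<beta>\<^sub>k| \<le> eps (|d\<^sub>k| + |d\<^sub>k\<^sub>+\<^sub>1|)\<close> implies this one with \<open>theta = 2\<close>.\<close>
definition negligible_sub :: "real \<Rightarrow> real \<Rightarrow> nat \<Rightarrow> gens \<Rightarrow> nat \<Rightarrow> bool" where
  "negligible_sub theta eps n g k \<longleftrightarrow> cmod (gb g k) \<le> theta * eps * spectral_norm (gmat n g)"

definition deflate ::
  "real \<Rightarrow> real \<Rightarrow> nat \<Rightarrow> nat \<Rightarrow> nat \<Rightarrow> gens \<Rightarrow> gens \<Rightarrow> bool" where
  "deflate theta eps n a b g g' \<longleftrightarrow>
     (\<exists>K\<subseteq>{a..<b}. (\<forall>k\<in>K. negligible_sub theta eps n g k) \<and>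
        g' = g\<lparr>gb := (\<lambda>k. if k \<in> K then 0 else gb g k)\<rparr>)"

text \<open>Triangular, or block triangular with diagonal blocks of size at most 2.\<close>
definition schur_shape :: "shift_mode \<Rightarrow> nat \<Rightarrow> nat \<Rightarrow> gens \<Rightarrow> bool" where
  "schur_shape mode a b g \<longleftrightarrow>
     (\<forall>i j. a \<le> j \<and> j + 1 < i \<and> i \<le> b \<longrightarrow> gbulge g i j = 0) \<and>
     (case mode of
        Single_Shift \<Rightarrow> \<forall>k. a \<le> k \<and> k < b \<longrightarrow> gb g k = 0
      | Double_Shift \<Rightarrow> \<forall>k. a \<le> k \<and> k + 1 < b \<longrightarrow> gb g k = 0 \<or> gb g (k + 1) = 0)"

section \<open>QR iteration\<close>

text \<open>Plain QR iteration on the part \<open>a, \<dots>, b\<close>; the first argument after \<open>b\<close> counts the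
  sweeps.\<close>
inductive qr_plain ::
  "shift_mode \<Rightarrow> real \<Rightarrow> fp \<Rightarrow> real \<Rightarrow> nat \<Rightarrow> nat \<Rightarrow> nat \<Rightarrow> nat \<Rightarrow> gens \<Rightarrow> gens \<Rightarrow> bool"
  for mode theta fl eps n a b where
  start: "deflate theta eps n a b g g' \<Longrightarrow> qr_plain mode theta fl eps n a b 0 g g'"
| sweeps: "qr_plain mode theta fl eps n a b s g g1 \<Longrightarrow> sweep_batch mode fl a b m g1 g2 \<Longrightarrow>
     deflate theta eps n a b g2 g' \<Longrightarrow> qr_plain mode theta fl eps n a b (s + m) g g'"

text \<open>Reduction of the spike (column \<open>w - 1\<close>, rows \<open>w, \<dots>, m\<close>) and the (quasi-)triangular
  block \<open>w, \<dots>, m\<close> to Hessenberg form. The spike entries are annihilated one at a time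
  starting from the bottom; the annihilations of bulge entries may be inserted in any
  order, in particular such that each bulge is chased to the bottom immediately.
  With \<open>2 \<times> 2\<close> diagonal blocks a bulge may consist of several entries.\<close>
definition hessenberg_reduction ::
  "nat \<Rightarrow> fp \<Rightarrow> nat \<Rightarrow> nat \<Rightarrow> gens \<Rightarrow> gens \<Rightarrow> bool" where
  "hessenberg_reduction N fl w m g g' \<longleftrightarrow>
     (\<exists>as. length as \<le> N \<and>
        (\<forall>(i, j)\<in>set as. w < i \<and> i \<le> m \<and> w - 1 \<le> j \<and> j + 1 < i) \<and>
        filter (\<lambda>(i, j). j = w - 1) as = map (\<lambda>i. (i, w - 1)) (rev [w + 1..<m + 1]) \<and>
        g' = fold (annihilate fl) as g \<and>
        (\<forall>i j. w - 1 \<le> j \<and> j + 1 < i \<and> i \<le> m \<longrightarrow> gbulge g' i j = 0))"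

text \<open>Aggressive early deflation on the trailing block \<open>w, \<dots>, hi\<close> of the split off block
  \<open>lo, \<dots>, hi\<close>. The rotations of the inner QR iteration also update the spike, which is
  column \<open>w - 1\<close> and initially equals \<open>gb g (w - 1)\<close> times the first unit vector.
  The spike entries in rows \<open>m + 1, \<dots>, hi\<close> are dropped, with \<open>m = w - 1\<close> if all are.\<close>
definition aed ::
  "shift_mode \<Rightarrow> nat \<Rightarrow> real \<Rightarrow> fp \<Rightarrow> real \<Rightarrow> nat \<Rightarrow> gens \<Rightarrow> gens \<Rightarrow> bool" where
  "aed mode kappa theta fl eps n g g' \<longleftrightarrow>
     (\<exists>lo hi w s m g1.
        split_block 0 (n - 1) g lo hi \<and> lo < w \<and> w \<le> hi \<and>
        qr_plain mode theta fl eps n w hi s g g1 \<and> s \<le> kappa * (hi + 1 - w) \<and>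
        schur_shape mode w hi g1 \<and>
        w - 1 \<le> m \<and> m \<le> hi \<and> (w \<le> m \<and> m < hi \<longrightarrow> gb g1 m = 0) \<and>
        (\<forall>i\<in>{m<..hi}. cmod (lower g1 i (w - 1)) \<le>
                          eps * min (cmod (gb g (w - 1))) (cmod (gd g1 i))) \<and>
        hessenberg_reduction (kappa * (hi + 1 - w)\<^sup>2) fl w m
          (set_lower (\<lambda>i j. if j = w - 1 \<and> m < i \<and> i \<le> hi then 0 else lower g1 i j) g1) g')"

text \<open>Each aggressive early deflation is counted like a sweep.\<close>
inductive qr_iteration ::
  "shift_mode \<Rightarrow> nat \<Rightarrow> real \<Rightarrow> fp \<Rightarrow> real \<Rightarrow> nat \<Rightarrow> nat \<Rightarrow> gens \<Rightarrow> gens \<Rightarrow> bool"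
  for mode kappa theta fl eps n where
  start: "deflate theta eps n 0 (n - 1) g g' \<Longrightarrow> qr_iteration mode kappa theta fl eps n 0 g g'"
| sweeps: "qr_iteration mode kappa theta fl eps n s g g1 \<Longrightarrow>
     sweep_batch mode fl 0 (n - 1) m g1 g2 \<Longrightarrow> deflate theta eps n 0 (n - 1) g2 g' \<Longrightarrow>
     qr_iteration mode kappa theta fl eps n (s + m) g g'"
| early: "qr_iteration mode kappa theta fl eps n s g g1 \<Longrightarrow>
     aed mode kappa theta fl eps n g1 g2 \<Longrightarrow> deflate theta eps n 0 (n - 1) g2 g' \<Longrightarrow>
     qr_iteration mode kappa theta fl eps n (Suc s) g g'"

text \<open>\<open>T\<close> is a Schur form computed within \<open>kappa * n\<close> sweeps. The algorithm delivers the
  generators of \<open>T\<close>, so that its entries above the diagonal can be understood either as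
  the exact values of the symmetry formula or as its floating point evaluation.\<close>
definition computed_schur_form ::
  "shift_mode \<Rightarrow> nat \<Rightarrow> real \<Rightarrow> fp \<Rightarrow> real \<Rightarrow> nat \<Rightarrow> (nat \<Rightarrow> complex) \<Rightarrow> complex mat \<Rightarrow> bool" where
  "computed_schur_form mode kappa theta fl eps n c T \<longleftrightarrow>
     (\<exists>s g. s \<le> kappa * n \<and>
        qr_iteration mode kappa theta fl eps n s (colleague_gens fl n c) g \<and>
        schur_shape mode 0 (n - 1) g \<and> (T = gmat n g \<or> T = fgmat fl n g))"

end

theory Submission
  imports Defs "HOL-Analysis.L2_Norm"
begin

text \<open>The generators determine their matrix \<open>M = F + u v\<^sup>*\<close> only through the Hermitian
  symmetry of \<open>F\<close>, and rounding destroys this symmetry on the diagonal. Two quantities are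
  therefore followed through the iteration: the distance of \<open>M\<close> from a unitary conjugate of
  the initial matrix, and the skew part \<open>F - F\<^sup>*\<close>. In Frobenius norm both are invariant under
  exact unitary similarities (with \<open>u\<close> and \<open>v\<close> rotated along). One rounded update adds
  \<open>O(n eps \<parallel>A\<parallel>)\<close> to the skew part, and rebuilding the upper triangle by the symmetry
  formula moves the matrix by at most the current skew part. After \<open>k\<close> updates the skew part is
  \<open>O(k n eps \<parallel>A\<parallel>)\<close>, hence the distance is \<open>O(k\<^sup>2 n eps \<parallel>A\<parallel>)\<close>. Since \<open>k\<close> is
  \<open>O(n\<^sup>3)\<close> and passing between Frobenius and spectral norm costs a factor \<open>n\<close>, this is
  a bound of order \<open>n\<^sup>8\<close>.\<close>

section \<open>Frobenius norm and unitary matrices\<close>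

text \<open>The standard model bounds errors relative to the operands, so absolute errors of order
  \<open>h * S\<close> require that all generators stay of bounded size. This comes from the tracked
  quantities themselves: as long as \<open>13 * k^2 * E \<le> 1\<close>, closeness to a unitary
  conjugate of the initial matrix gives \<open>bounded\<close>, which is what the analysis of the
  next update assumes. The smallness condition on \<open>eps\<close> makes this induction run to the
  end and replaces a first-order argument. Each computed rotation is compared with the exact
  rotation for the same two numbers, however inaccurate these are, so the quality of the shifts
  never matters. Only where entries are overwritten by a norm and by zeros must those two numbers be
  the entries concerned. The Frobenius norm is not only unitarily invariant but also monotone in the
  moduli of the entries; this allows the rebuilt upper triangle to be compared with the skew part.
  That the bound is relative to the norm of \<open>A\<close> itself is special to the colleague
  matrix: as \<open>u\<close> is the first unit vector, \<open>v\<close> can be read off the first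
  row, and the subdiagonal entries of at least 1/2 bound the entries of \<open>F\<close> by the
  norm.\<close>

abbreviation (input) adj :: "complex mat \<Rightarrow> complex mat" where "adj \<equiv> mat_adjoint"

lemma adj_dim [simp]: "dim_row (adj A) = dim_col A" "dim_col (adj A) = dim_row A"
  by (simp_all add: mat_adjoint_def)

lemma adj_carrier [simp]: "adj A \<in> carrier_mat n m \<longleftrightarrow> A \<in> carrier_mat m n"
  unfolding carrier_mat_def mem_Collect_eq adj_dim by (rule conj_commute)

lemma adj_index [simp]:
  "i < dim_col A \<Longrightarrow> j < dim_row A \<Longrightarrow> adj A $$ (i, j) = cnj (A $$ (j, i))"
  by (simp add: mat_adjoint_def mat_of_rows_index)

lemma adj_adj [simp]: "adj (adj A) = A"
  by (rule eq_matI) auto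

lemma adj_mult: "A \<in> carrier_mat n m \<Longrightarrow> B \<in> carrier_mat m k \<Longrightarrow> adj (A * B) = adj B * adj A"
  by (rule eq_matI) (auto simp: scalar_prod_def mult.commute intro!: sum.cong)

lemma adj_minus: "A \<in> carrier_mat n m \<Longrightarrow> B \<in> carrier_mat n m \<Longrightarrow> adj (A - B) = adj A - adj B"
  by (rule eq_matI) auto

definition fro :: "complex mat \<Rightarrow> real" where
  "fro A = L2_set (\<lambda>x. cmod (A $$ x)) ({..<dim_row A} \<times> {..<dim_col A})"

lemma fro_nonneg [simp]: "0 \<le> fro A"
  by (simp add: fro_def)

lemma fro_adj [simp]: "fro (adj A) = fro A"
proof -
  have "(\<Sum>x\<in>{..<dim_col A} \<times> {..<dim_row A}. (cmod (adj A $$ x))\<^sup>2)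
      = (\<Sum>x\<in>{..<dim_row A} \<times> {..<dim_col A}. (cmod (A $$ x))\<^sup>2)"
    by (rule sum.reindex_bij_witness[of _ prod.swap prod.swap]) auto
  thus ?thesis by (simp add: fro_def L2_set_def)
qed

lemma fro_triangle:
  assumes "A \<in> carrier_mat n m" "B \<in> carrier_mat n m"
  shows "fro (A + B) \<le> fro A + fro B"
proof -
  have "fro (A + B) \<le> L2_set (\<lambda>x. cmod (A $$ x) + cmod (B $$ x)) ({..<n} \<times> {..<m})"
    unfolding fro_def using assms by (auto intro!: L2_set_mono norm_triangle_ineq)
  also have "\<dots> \<le> fro A + fro B"
    unfolding fro_def using assms L2_set_triangle_ineq by auto
  finally show ?thesis .
qed

lemma fro_triangle_minus:
  assumes "A \<in> carrier_mat n m" "B \<in> carrier_mat n m"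
  shows "fro (A - B) \<le> fro A + fro B"
proof -
  have "fro (A - B) \<le> L2_set (\<lambda>x. cmod (A $$ x) + cmod (B $$ x)) ({..<n} \<times> {..<m})"
    unfolding fro_def using assms by (auto intro!: L2_set_mono norm_triangle_ineq4)
  also have "\<dots> \<le> fro A + fro B"
    unfolding fro_def using assms L2_set_triangle_ineq by auto
  finally show ?thesis .
qed

lemma fro_diff_triangle:
  assumes "A \<in> carrier_mat n m" "B \<in> carrier_mat n m" "C \<in> carrier_mat n m"
  shows "fro (A - C) \<le> fro (A - B) + fro (B - C)"
proof -
  have "A - C = (A - B) + (B - C)" using assms by (intro eq_matI) auto
  thus ?thesis using fro_triangle[of "A - B" n m "B - C"] assms
    by (simp add: minus_carrier_mat)
qed

lemma fro_le_add:
  assumes "A \<in> carrier_mat n m" "B \<in> carrier_mat n m"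
  shows "fro A \<le> fro (A - B) + fro B"
proof -
  have "A = (A - B) + B" using assms by (intro eq_matI) auto
  thus ?thesis using fro_triangle[of "A - B" n m B] assms by (simp add: minus_carrier_mat)
qed

lemma fro_entry:
  assumes "A \<in> carrier_mat n m" "i < n" "j < m"
  shows "cmod (A $$ (i, j)) \<le> fro A"
  unfolding fro_def using assms
  by (intro order_trans[OF _ member_le_L2_set[of _ "(i, j)"]]) auto

lemma fro_mono:
  assumes "A \<in> carrier_mat n m" "B \<in> carrier_mat n m"
    and "\<And>i j. i < n \<Longrightarrow> j < m \<Longrightarrow> cmod (A $$ (i, j)) \<le> cmod (B $$ (i, j))"
  shows "fro A \<le> fro B"
  unfolding fro_def using assms by (auto intro!: L2_set_mono)

text \<open>The condition \<open>m \<le> n\<close> lets one statement serve both square matrices and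
  single columns. For a column a factor \<open>sqrt n\<close> would do; the difference is given
  away.\<close>

lemma fro_le_max:
  assumes "A \<in> carrier_mat n m" "m \<le> n" "0 \<le> e"
    and "\<And>i j. i < n \<Longrightarrow> j < m \<Longrightarrow> cmod (A $$ (i, j)) \<le> e"
  shows "fro A \<le> real n * e"
proof -
  have "fro A \<le> L2_set (\<lambda>_. e) ({..<n} \<times> {..<m})"
    unfolding fro_def using assms by (auto intro!: L2_set_mono)
  also have "\<dots> = sqrt (real n * real m) * e"
    using assms by (simp add: L2_set_constant)
  also have "sqrt (real n * real m) \<le> sqrt (real n * real n)"
    using assms by (intro real_sqrt_le_mono mult_left_mono) auto
  finally show ?thesis using \<open>0 \<le> e\<close> by (simp add: mult_right_mono)
qed

lemma fro_sq: "(fro A)\<^sup>2 = (\<Sum>i<dim_row A. \<Sum>j<dim_col A. (cmod (A $$ (i, j)))\<^sup>2)"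
  by (simp add: fro_def L2_set_def sum_nonneg sum.cartesian_product case_prod_unfold)

lemma fro_mult:
  assumes "A \<in> carrier_mat n m" "B \<in> carrier_mat m k"
  shows "fro (A * B) \<le> fro A * fro B"
proof -
  have "(cmod ((A * B) $$ (i, j)))\<^sup>2 \<le>
      (\<Sum>l<m. (cmod (A $$ (i, l)))\<^sup>2) * (\<Sum>l<m. (cmod (B $$ (l, j)))\<^sup>2)"
    if "i < n" "j < k" for i j
  proof -
    have "cmod ((A * B) $$ (i, j)) \<le> (\<Sum>l<m. \<bar>cmod (A $$ (i, l))\<bar> * \<bar>cmod (B $$ (l, j))\<bar>)"
      using assms that
      by (auto simp: scalar_prod_def lessThan_atLeast0 norm_mult[symmetric] intro!: sum_norm_le)
    also have "\<dots> \<le> L2_set (\<lambda>l. cmod (A $$ (i, l))) {..<m} * L2_set (\<lambda>l. cmod (B $$ (l, j))) {..<m}"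
      by (rule L2_set_mult_ineq)
    finally have "(cmod ((A * B) $$ (i, j)))\<^sup>2 \<le>
        (L2_set (\<lambda>l. cmod (A $$ (i, l))) {..<m} * L2_set (\<lambda>l. cmod (B $$ (l, j))) {..<m})\<^sup>2"
      by (intro power_mono) auto
    thus ?thesis by (simp add: L2_set_def power_mult_distrib sum_nonneg)
  qed
  hence "(fro (A * B))\<^sup>2 \<le> (\<Sum>i<n. \<Sum>j<k.
      (\<Sum>l<m. (cmod (A $$ (i, l)))\<^sup>2) * (\<Sum>l<m. (cmod (B $$ (l, j)))\<^sup>2))"
    unfolding fro_sq using assms by (auto intro!: sum_mono)
  also have "\<dots> = (\<Sum>i<n. \<Sum>l<m. (cmod (A $$ (i, l)))\<^sup>2) * (\<Sum>j<k. \<Sum>l<m. (cmod (B $$ (l, j)))\<^sup>2)"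
    by (rule sum_product[symmetric])
  also have "(\<Sum>j<k. \<Sum>l<m. (cmod (B $$ (l, j)))\<^sup>2) = (\<Sum>l<m. \<Sum>j<k. (cmod (B $$ (l, j)))\<^sup>2)"
    by (rule sum.swap)
  also have "(\<Sum>i<n. \<Sum>l<m. (cmod (A $$ (i, l)))\<^sup>2) * \<dots> = (fro A)\<^sup>2 * (fro B)\<^sup>2"
    unfolding fro_sq using assms by simp
  finally have "(fro (A * B))\<^sup>2 \<le> (fro A * fro B)\<^sup>2"
    by (simp only: power_mult_distrib)
  thus ?thesis by (rule power2_le_imp_le) simp
qed

section \<open>Unitary matrices and invariance of the Frobenius norm\<close>

lemma unitary_carrier: "unitary n Q \<Longrightarrow> Q \<in> carrier_mat n n"
  by (simp add: unitary_def)

lemma unitary_left: "unitary n Q \<Longrightarrow> adj Q * Q = 1\<^sub>m n"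
  by (simp add: unitary_def)

lemma unitary_right: "unitary n Q \<Longrightarrow> Q * adj Q = 1\<^sub>m n"
  by (meson mat_mult_left_right_inverse unitary_def adj_carrier)

lemma unitary_adj: "unitary n Q \<Longrightarrow> unitary n (adj Q)"
  using unitary_right by (simp add: unitary_def)

lemma unitary_one: "unitary n (1\<^sub>m n)"
proof -
  have "adj (1\<^sub>m n) = 1\<^sub>m n" by (rule eq_matI) auto
  thus ?thesis by (simp add: unitary_def)
qed

lemma unitary_mult:
  assumes "unitary n Q" "unitary n R"
  shows "unitary n (Q * R)"
proof -
  have c: "Q \<in> carrier_mat n n" "R \<in> carrier_mat n n" using assms by (auto simp: unitary_def)
  have "adj (Q * R) * (Q * R) = adj R * (adj Q * Q) * R"
    using c by (simp add: adj_mult assoc_mult_mat[of _ n n _ n _ n])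
  thus ?thesis using assms c by (simp add: unitary_def)
qed

text \<open>In \<open>adj (Q * A) * (Q * A)\<close> a unitary \<open>Q\<close> cancels, so writing
  the norm through the diagonal of such a product makes unitary invariance immediate.\<close>

lemma fro_sq_trace:
  assumes "A \<in> carrier_mat n m"
  shows "complex_of_real ((fro A)\<^sup>2) = (\<Sum>j<m. (adj A * A) $$ (j, j))"
proof -
  have "(\<Sum>j<m. (adj A * A) $$ (j, j)) = (\<Sum>j<m. \<Sum>i<n. complex_of_real ((cmod (A $$ (i, j)))\<^sup>2))"
    using assms by (auto simp: scalar_prod_def lessThan_atLeast0 complex_norm_square mult.commute
      simp del: of_real_power intro!: sum.cong)
  also have "\<dots> = complex_of_real ((fro A)\<^sup>2)"
    using assms sum.swap[of "\<lambda>i j. (cmod (A $$ (i, j)))\<^sup>2" "{..<m}" "{..<n}"]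
    by (simp add: fro_sq)
  finally show ?thesis by simp
qed

lemma fro_unitary_left:
  assumes "unitary n Q" "A \<in> carrier_mat n m"
  shows "fro (Q * A) = fro A"
proof -
  have Q: "Q \<in> carrier_mat n n" using assms by (auto simp: unitary_def)
  have "adj (Q * A) * (Q * A) = adj A * ((adj Q * Q) * A)"
    using Q assms by (simp add: adj_mult[of _ n n _ m] assoc_mult_mat[of _ m n _ n _ m]
        assoc_mult_mat[of _ n n _ n _ m])
  hence "complex_of_real ((fro (Q * A))\<^sup>2) = complex_of_real ((fro A)\<^sup>2)"
    using assms Q fro_sq_trace[of "Q * A" n m] fro_sq_trace[of A n m]
    by (simp add: unitary_left)
  thus ?thesis by (simp add: power2_eq_iff_nonneg del: of_real_power)
qed

lemma fro_unitary_right: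
  assumes "unitary n Q" "A \<in> carrier_mat m n"
  shows "fro (A * Q) = fro A"
proof -
  have Q: "Q \<in> carrier_mat n n" using assms by (auto simp: unitary_def)
  have "fro (A * Q) = fro (adj (A * Q))" by simp
  also have "\<dots> = fro (adj A)"
    using Q assms by (simp add: adj_mult[of _ m n _ n] fro_unitary_left[where n = n and m = m] unitary_adj del: fro_adj)
  finally show ?thesis by simp
qed

lemma fro_unitary_similar:
  assumes "unitary n Q" "A \<in> carrier_mat n n"
  shows "fro (adj Q * A * Q) = fro A"
  using assms unitary_carrier[OF assms(1)]
  by (subst fro_unitary_right[where m = n]) (auto simp: fro_unitary_left[where n = n and m = n] unitary_adj)

section \<open>Comparison of the spectral and Frobenius norms\<close>

lemma euclid_norm_fro: "euclid_norm x = fro (mat (dim_vec x) 1 (\<lambda>(i, j). x $ i))"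
  unfolding euclid_norm_def using fro_sq[of "mat (dim_vec x) 1 (\<lambda>(i, j). x $ i)"]
  by (intro real_sqrt_unique) auto

lemma euclid_norm_mult_le: 
  assumes "x \<in> carrier_vec (dim_col A)"
  shows "euclid_norm (A *\<^sub>v x) \<le> fro A * euclid_norm x"
proof -
  have "mat (dim_vec (A *\<^sub>v x)) 1 (\<lambda>(i, j). (A *\<^sub>v x) $ i) = A * mat (dim_vec x) 1 (\<lambda>(i, j). x $ i)"
    using assms by (intro eq_matI) (auto simp: scalar_prod_def)
  thus ?thesis
    using fro_mult[of A "dim_row A" "dim_col A" "mat (dim_vec x) 1 (\<lambda>(i, j). x $ i)" 1] assms
    by (simp add: euclid_norm_fro)
qed

lemma spectral_norm_le_fro: "spectral_norm A \<le> fro A"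
  unfolding spectral_norm_def
proof (rule cSup_least)
  show "{euclid_norm (A *\<^sub>v x) |x. x \<in> carrier_vec (dim_col A) \<and> euclid_norm x \<le> 1} \<noteq> {}"
    by (auto intro!: exI[of _ "0\<^sub>v (dim_col A)"] simp: euclid_norm_def)
  fix y assume "y \<in> {euclid_norm (A *\<^sub>v x) |x. x \<in> carrier_vec (dim_col A) \<and> euclid_norm x \<le> 1}"
  then obtain x where x: "y = euclid_norm (A *\<^sub>v x)" "x \<in> carrier_vec (dim_col A)" "euclid_norm x \<le> 1"
    by auto
  show "y \<le> fro A"
    using euclid_norm_mult_le[OF x(2)] mult_left_mono[OF x(3), of "fro A"] x(1) by simp
qed

text \<open>The entry is a component of the image of a unit vector. The supremum is meaningful only
  for a bounded set, and the Frobenius norm supplies the bound.\<close>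

lemma entry_le_spectral_norm:
  assumes "A \<in> carrier_mat n m" "i < n" "j < m"
  shows "cmod (A $$ (i, j)) \<le> spectral_norm A"
proof -
  have "cmod (A $$ (i, j)) = cmod ((A *\<^sub>v unit_vec m j) $ i)"
    using assms by (simp add: scalar_prod_right_unit)
  also have "\<dots> \<le> euclid_norm (A *\<^sub>v unit_vec m j)"
    unfolding euclid_norm_def using assms
    by (intro real_le_rsqrt member_le_sum[of i _ "\<lambda>i. (cmod ((A *\<^sub>v unit_vec m j) $ i))\<^sup>2"]) auto
  also have "\<dots> \<le> spectral_norm A"
    unfolding spectral_norm_def
  proof (rule cSup_upper)
    have "(\<Sum>i<m. (cmod (unit_vec m j $ i :: complex))\<^sup>2) = (\<Sum>i<m. if i = j then 1 else 0)"
      using assms by (intro sum.cong) (auto simp: unit_vec_def)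
    hence "euclid_norm (unit_vec m j) = 1"
      using assms by (simp add: euclid_norm_def)
    thus "euclid_norm (A *\<^sub>v unit_vec m j)
        \<in> {euclid_norm (A *\<^sub>v x) |x. x \<in> carrier_vec (dim_col A) \<and> euclid_norm x \<le> 1}"
      using assms by auto
    have "y \<le> fro A" if "y = euclid_norm (A *\<^sub>v x)" "x \<in> carrier_vec (dim_col A)" "euclid_norm x \<le> 1"
      for x y
      using euclid_norm_mult_le[OF that(2)] mult_left_mono[OF that(3), of "fro A"] that(1) by simp
    thus "bdd_above {euclid_norm (A *\<^sub>v x) |x. x \<in> carrier_vec (dim_col A) \<and> euclid_norm x \<le> 1}"
      by (intro bdd_aboveI[of _ "fro A"]) auto
  qed
  finally show ?thesis .
qed

lemma spectral_norm_nonneg: "A \<in> carrier_mat n m \<Longrightarrow> 0 < n \<Longrightarrow> 0 < m \<Longrightarrow> 0 \<le> spectral_norm A"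
  using entry_le_spectral_norm[of A n m 0 0] norm_ge_zero order_trans by blast

lemma fro_le_spectral_norm:
  assumes "A \<in> carrier_mat n n" "0 < n"
  shows "fro A \<le> real n * spectral_norm A"
  using assms by (intro fro_le_max entry_le_spectral_norm[OF assms(1)] spectral_norm_nonneg) auto

section \<open>Rounding errors of Givens rotations\<close>

text \<open>One constant \<open>h\<close>, later \<open>max 1 mu * eps\<close>, covers real and
  complex operations alike; the bound 1/1000 absorbs all higher powers of \<open>h\<close>. The
  separate laws for real operands keep the computed sum of squares real, so that taking
  \<open>Re\<close> in \<open>givens_norm\<close> loses nothing.\<close>

locale rounding =
  fixes fl :: fp and h :: real
  assumes h_nonneg: "0 \<le> h" and h_small: "h \<le> 1 / 1000"
    and add_ex: "\<exists>\<delta>. cmod \<delta> \<le> h \<and> fadd fl a b = (a + b) * (1 + \<delta>)"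
    and sub_ex: "\<exists>\<delta>. cmod \<delta> \<le> h \<and> fsub fl a b = (a - b) * (1 + \<delta>)"
    and mul_ex: "\<exists>\<delta>. cmod \<delta> \<le> h \<and> fmul fl a b = (a * b) * (1 + \<delta>)"
    and div_ex: "b \<noteq> 0 \<Longrightarrow> \<exists>\<delta>. cmod \<delta> \<le> h \<and> fdiv fl a b = (a / b) * (1 + \<delta>)"
    and add_real: "\<exists>\<delta>. \<bar>\<delta>\<bar> \<le> h \<and>
      fadd fl (complex_of_real x) (complex_of_real y) = complex_of_real ((x + y) * (1 + \<delta>))"
    and mul_real: "\<exists>\<delta>. \<bar>\<delta>\<bar> \<le> h \<and>
      fmul fl (complex_of_real x) (complex_of_real y) = complex_of_real ((x * y) * (1 + \<delta>))"
    and sqrt_ex: "0 \<le> x \<Longrightarrow> \<exists>\<delta>. \<bar>\<delta>\<bar> \<le> h \<and> fsqrt fl x = sqrt x * (1 + \<delta>)"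

lemma standard_model_rounding:
  assumes "standard_model mu eps fl" "0 \<le> eps" "max 1 mu * eps \<le> 1 / 1000"
  shows "rounding fl (max 1 mu * eps)"
proof -
  let ?h = "max 1 mu * eps"
  have le: "eps \<le> ?h" "mu * eps \<le> ?h"
    using assms(2) mult_right_mono[of 1 "max 1 mu" eps] mult_right_mono[of mu "max 1 mu" eps] by auto
  have c: "\<exists>\<delta>. cmod \<delta> \<le> ?h \<and> y = z * (1 + \<delta>)" if "rounded mu eps a b z y" for a b z y
    using that le order_trans unfolding rounded_def by blast
  have r: "\<exists>\<delta>. \<bar>\<delta>\<bar> \<le> ?h \<and> y = complex_of_real (t * (1 + \<delta>))"
    if *: "rounded mu eps (complex_of_real a) (complex_of_real b) (complex_of_real t) y" for a b t y
  proof -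
    obtain \<delta> :: real where "\<bar>\<delta>\<bar> \<le> eps" "y = complex_of_real t * (1 + complex_of_real \<delta>)"
      using * Reals_of_real unfolding rounded_def by blast
    thus ?thesis using le by (intro exI[of _ \<delta>]) auto
  qed
  show ?thesis
  proof
    show "0 \<le> ?h" using assms(2) by simp
    show "?h \<le> 1 / 1000" by fact
    show "\<exists>\<delta>. \<bar>\<delta>\<bar> \<le> ?h \<and>
      fadd fl (complex_of_real x) (complex_of_real y) = complex_of_real ((x + y) * (1 + \<delta>))" for x y
      using r[of x y "x + y"] assms(1) by (simp add: standard_model_def)
    show "\<exists>\<delta>. \<bar>\<delta>\<bar> \<le> ?h \<and>
      fmul fl (complex_of_real x) (complex_of_real y) = complex_of_real ((x * y) * (1 + \<delta>))" for x y
      using r[of x y "x * y"] assms(1) by (simp add: standard_model_def)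
    show "\<exists>\<delta>. \<bar>\<delta>\<bar> \<le> ?h \<and> fsqrt fl x = sqrt x * (1 + \<delta>)" if "0 \<le> x" for x
      using that assms(1) le unfolding standard_model_def by (meson order_trans)
  qed (use assms(1)[unfolded standard_model_def] in \<open>blast intro: c\<close>)+
qed

text \<open>The factor 10 is the one obtained in \<open>div_norm_approx\<close>.\<close>

fun near_rot :: "real \<Rightarrow> rot \<Rightarrow> rot \<Rightarrow> bool" where
  "near_rot h (k, c, s) (k', c', s') \<longleftrightarrow>
     k = k' \<and> cmod (c - c') \<le> 10 * h \<and> cmod (s - s') \<le> 10 * h"

fun unit_rot :: "nat \<Rightarrow> rot \<Rightarrow> bool" where
  "unit_rot n (k, c, s) \<longleftrightarrow> Suc k < n \<and> (cmod c)\<^sup>2 + (cmod s)\<^sup>2 = 1"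

text \<open>The arrays of the algorithm are functions on all pairs of indices, their exact
  counterparts are matrices; the standard model gives errors entry by entry, and these are converted
  to a norm only at the end of an update.\<close>

definition near :: "nat \<Rightarrow> nat \<Rightarrow> real \<Rightarrow> (nat \<Rightarrow> nat \<Rightarrow> complex) \<Rightarrow> complex mat \<Rightarrow> bool" where
  "near n m e M X \<longleftrightarrow> (\<forall>i<n. \<forall>j<m. cmod (M i j - X $$ (i, j)) \<le> e)"

lemma near_mono: "near n m e M X \<Longrightarrow> e \<le> e' \<Longrightarrow> near n m e' M X"
  by (auto simp: near_def intro: order_trans)

context rounding
begin

lemma add_err: "cmod (fadd fl a b - (a + b)) \<le> h * cmod (a + b)"
proof -
  obtain \<delta> where d: "cmod \<delta> \<le> h" "fadd fl a b = (a + b) * (1 + \<delta>)" using add_ex by blast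
  have "fadd fl a b - (a + b) = \<delta> * (a + b)" by (simp add: d(2) algebra_simps)
  thus ?thesis using d(1) by (simp add: norm_mult mult_right_mono)
qed

lemma sub_err: "cmod (fsub fl a b - (a - b)) \<le> h * cmod (a - b)"
proof -
  obtain \<delta> where d: "cmod \<delta> \<le> h" "fsub fl a b = (a - b) * (1 + \<delta>)" using sub_ex by blast
  have "fsub fl a b - (a - b) = \<delta> * (a - b)" by (simp add: d(2) algebra_simps)
  thus ?thesis using d(1) by (simp add: norm_mult mult_right_mono)
qed

lemma mul_err: "cmod (fmul fl a b - a * b) \<le> h * cmod (a * b)"
proof -
  obtain \<delta> where d: "cmod \<delta> \<le> h" "fmul fl a b = (a * b) * (1 + \<delta>)" using mul_ex by blast
  have "fmul fl a b - a * b = \<delta> * (a * b)" by (simp add: d(2) algebra_simps)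
  thus ?thesis using d(1) by (simp only: norm_mult[of \<delta>] mult_right_mono norm_ge_zero)
qed

lemma div_err: "b \<noteq> 0 \<Longrightarrow> cmod (fdiv fl a b - a / b) \<le> h * cmod (a / b)"
proof -
  assume "b \<noteq> 0"
  then obtain \<delta> where d: "cmod \<delta> \<le> h" "fdiv fl a b = (a / b) * (1 + \<delta>)" using div_ex by blast
  have "fdiv fl a b - a / b = \<delta> * (a / b)" unfolding d(2) by (simp only: ring_distribs mult_1_right) simp
  thus ?thesis using d(1) by (simp only: norm_mult[of \<delta>] mult_right_mono norm_ge_zero)
qed

lemma add_approx:
  assumes "cmod (p - p') \<le> e" "cmod (q - q') \<le> e" "cmod p' \<le> b" "cmod q' \<le> b"
  shows "cmod (fadd fl p q - (p' + q')) \<le> 2 * e + h * (2 * b + 2 * e)"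
proof -
  have 1: "cmod (p + q - (p' + q')) \<le> 2 * e"
    using norm_triangle_ineq[of "p - p'" "q - q'"] assms by (simp add: algebra_simps)
  have "cmod (p + q) \<le> 2 * b + 2 * e"
    using 1 norm_triangle_ineq[of "p + q - (p' + q')" "p' + q'"] norm_triangle_ineq[of p' q'] assms
    by simp
  hence "cmod (fadd fl p q - (p + q)) \<le> h * (2 * b + 2 * e)"
    using add_err[of p q] mult_left_mono[OF _ h_nonneg] order_trans by blast
  thus ?thesis
    using 1 norm_diff_triangle_le by fastforce
qed

lemma sub_approx:
  assumes "cmod (p - p') \<le> e" "cmod (q - q') \<le> e" "cmod p' \<le> b" "cmod q' \<le> b"
  shows "cmod (fsub fl p q - (p' - q')) \<le> 2 * e + h * (2 * b + 2 * e)"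
proof -
  have 1: "cmod (p - q - (p' - q')) \<le> 2 * e"
    using norm_triangle_ineq4[of "p - p'" "q - q'"] assms by (simp add: algebra_simps)
  have "cmod (p - q) \<le> 2 * b + 2 * e"
    using 1 norm_triangle_ineq[of "p - q - (p' - q')" "p' - q'"] norm_triangle_ineq4[of p' q'] assms
    by simp
  hence "cmod (fsub fl p q - (p - q)) \<le> h * (2 * b + 2 * e)"
    using sub_err[of p q] mult_left_mono[OF _ h_nonneg] order_trans by blast
  thus ?thesis
    using 1 norm_diff_triangle_le by fastforce
qed

text \<open>The premise \<open>30 * h * b \<le> e\<close> says that the inherited error dominates
  every newly committed one: replacing \<open>c\<close> by \<open>c'\<close> costs at most
  \<open>10 * h * b\<close>, a third of \<open>e\<close>. Errors therefore grow by constant factors,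
  and no separate additive terms need to be carried along.\<close>

lemma mul_approx:
  assumes "cmod (c - c') \<le> 10 * h" "cmod c' \<le> 1" "cmod (x - y) \<le> e" "cmod y \<le> b"
    and "30 * h * b \<le> e"
  shows "cmod (fmul fl c x - c' * y) \<le> 3 / 2 * e"
proof -
  have b: "0 \<le> b" using assms(4) norm_ge_zero order_trans by blast
  have e: "0 \<le> e" using assms(3) norm_ge_zero order_trans by blast
  have c: "cmod c \<le> 101 / 100"
    using norm_triangle_ineq[of "c - c'" c'] assms(1,2) h_small by simp
  have x: "cmod x \<le> b + e" using norm_triangle_ineq[of "x - y" y] assms by simp
  have "cmod (c * x) \<le> 101 / 100 * (b + e)"
    unfolding norm_mult using c x e b by (intro mult_mono) auto
  hence 1: "cmod (fmul fl c x - c * x) \<le> h * (101 / 100 * (b + e))"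
    using mul_err[of c x] mult_left_mono[OF _ h_nonneg] order_trans by blast
  have "c * x - c' * y = c * (x - y) + (c - c') * y" by (simp add: algebra_simps)
  hence "cmod (c * x - c' * y) \<le> cmod c * cmod (x - y) + cmod (c - c') * cmod y"
    by (metis norm_mult norm_triangle_ineq)
  also have "\<dots> \<le> 101 / 100 * e + 10 * h * b"
    using c assms e b h_nonneg by (intro add_mono mult_mono) auto
  finally have 2: "cmod (c * x - c' * y) \<le> 101 / 100 * e + 10 * h * b" .
  have "h * e \<le> 1 / 1000 * e" using h_small e by (intro mult_right_mono) auto
  thus ?thesis
    using 1 2 assms(5) e norm_triangle_ineq[of "fmul fl c x - c * x" "c * x - c' * y"]
    by (simp add: algebra_simps)
qed

text \<open>The mirrored version for column rotations, as \<open>fmul\<close> is not assumed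
  commutative.\<close>

lemma mul_approx':
  assumes "cmod (c - c') \<le> 10 * h" "cmod c' \<le> 1" "cmod (x - y) \<le> e" "cmod y \<le> b"
    and "30 * h * b \<le> e"
  shows "cmod (fmul fl x c - c' * y) \<le> 3 / 2 * e"
proof -
  have b: "0 \<le> b" using assms(4) norm_ge_zero order_trans by blast
  have e: "0 \<le> e" using assms(3) norm_ge_zero order_trans by blast
  have c: "cmod c \<le> 101 / 100"
    using norm_triangle_ineq[of "c - c'" c'] assms(1,2) h_small by simp
  have x: "cmod x \<le> b + e" using norm_triangle_ineq[of "x - y" y] assms by simp
  have "cmod (x * c) \<le> (b + e) * (101 / 100)"
    unfolding norm_mult using c x e b by (intro mult_mono) auto
  hence 1: "cmod (fmul fl x c - x * c) \<le> h * ((b + e) * (101 / 100))"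
    using mul_err[of x c] mult_left_mono[OF _ h_nonneg] order_trans by blast
  have "x * c - c' * y = c * (x - y) + (c - c') * y" by (simp add: algebra_simps)
  hence "cmod (x * c - c' * y) \<le> cmod c * cmod (x - y) + cmod (c - c') * cmod y"
    by (metis norm_mult norm_triangle_ineq)
  also have "\<dots> \<le> 101 / 100 * e + 10 * h * b"
    using c assms e b h_nonneg by (intro add_mono mult_mono) auto
  finally have 2: "cmod (x * c - c' * y) \<le> 101 / 100 * e + 10 * h * b" .
  have "h * e \<le> 1 / 1000 * e" using h_small e by (intro mult_right_mono) auto
  thus ?thesis
    using 1 2 assms(5) e norm_triangle_ineq[of "fmul fl x c - x * c" "x * c - c' * y"]
    by (simp add: algebra_simps)
qed

lemma combine_le:
  assumes "0 \<le> e" "30 * h * b \<le> e"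
  shows "2 * (3 / 2 * e) + h * (2 * b + 2 * (3 / 2 * e)) \<le> 4 * e"
proof -
  have "h * e \<le> 1 / 1000 * e" using h_small assms(1) by (intro mult_right_mono) auto
  thus ?thesis using assms by (simp add: algebra_simps)
qed

text \<open>Both squares are nonnegative, so their sum suffers no cancellation: one factor between
  \<open>1 - h\<close> and \<open>1 + h\<close> comes from the multiplications and one from the
  addition.\<close>

lemma fabs2_approx:
  obtains t where "fabs2 fl z = complex_of_real t"
    "(1 - h)\<^sup>2 * (cmod z)\<^sup>2 \<le> t" "t \<le> (1 + h)\<^sup>2 * (cmod z)\<^sup>2"
proof -
  obtain a where a: "\<bar>a\<bar> \<le> h" "fmul fl (Re z) (Re z) = complex_of_real ((Re z * Re z) * (1 + a))"
    using mul_real by blast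
  obtain b where b: "\<bar>b\<bar> \<le> h" "fmul fl (Im z) (Im z) = complex_of_real ((Im z * Im z) * (1 + b))"
    using mul_real by blast
  let ?w = "(Re z * Re z) * (1 + a) + (Im z * Im z) * (1 + b)"
  obtain d where d: "\<bar>d\<bar> \<le> h" "fadd fl (complex_of_real ((Re z * Re z) * (1 + a)))
      (complex_of_real ((Im z * Im z) * (1 + b))) = complex_of_real (?w * (1 + d))"
    using add_real by blast
  have z: "(cmod z)\<^sup>2 = Re z * Re z + Im z * Im z"
    by (simp add: cmod_power2 flip: power2_eq_square)
  have "Re z * Re z * (1 - h) + Im z * Im z * (1 - h) \<le> ?w"
    using a b by (intro add_mono mult_left_mono) auto
  moreover have "?w \<le> Re z * Re z * (1 + h) + Im z * Im z * (1 + h)"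
    using a b by (intro add_mono mult_left_mono) auto
  ultimately have w: "(cmod z)\<^sup>2 * (1 - h) \<le> ?w" "?w \<le> (cmod z)\<^sup>2 * (1 + h)"
    by (simp_all add: z algebra_simps)
  have h1: "0 \<le> 1 - h" using h_small by simp
  have w0: "0 \<le> (cmod z)\<^sup>2 * (1 - h)" "0 \<le> ?w"
    using h1 order_trans[OF _ w(1)] by simp_all
  show ?thesis
  proof
    show "fabs2 fl z = complex_of_real (?w * (1 + d))"
      by (simp only: fabs2_def a b d)
    have "(1 - h)\<^sup>2 * (cmod z)\<^sup>2 = (cmod z)\<^sup>2 * (1 - h) * (1 - h)"
      by (simp add: power2_eq_square algebra_simps)
    also have "\<dots> \<le> ?w * (1 + d)"
      using w w0 d h1 by (intro mult_mono) auto
    finally show "(1 - h)\<^sup>2 * (cmod z)\<^sup>2 \<le> ?w * (1 + d)" .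
    have "?w * (1 + d) \<le> (cmod z)\<^sup>2 * (1 + h) * (1 + h)"
      using w w0 d h_small h_nonneg by (intro mult_mono) auto
    thus "?w * (1 + d) \<le> (1 + h)\<^sup>2 * (cmod z)\<^sup>2"
      by (simp add: power2_eq_square algebra_simps)
  qed
qed

lemma givens_norm_approx:
  fixes a b :: complex
  defines "\<rho> \<equiv> sqrt ((cmod a)\<^sup>2 + (cmod b)\<^sup>2)"
  obtains r where "givens_norm fl a b = complex_of_real r" "\<bar>r - \<rho>\<bar> \<le> 4 * h * \<rho>"
proof -
  obtain s where s: "fabs2 fl a = complex_of_real s"
    "(1 - h)\<^sup>2 * (cmod a)\<^sup>2 \<le> s" "s \<le> (1 + h)\<^sup>2 * (cmod a)\<^sup>2"
    by (rule fabs2_approx)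
  obtain t where t: "fabs2 fl b = complex_of_real t"
    "(1 - h)\<^sup>2 * (cmod b)\<^sup>2 \<le> t" "t \<le> (1 + h)\<^sup>2 * (cmod b)\<^sup>2"
    by (rule fabs2_approx)
  obtain d where d: "\<bar>d\<bar> \<le> h"
    "fadd fl (complex_of_real s) (complex_of_real t) = complex_of_real ((s + t) * (1 + d))"
    using add_real by blast
  have rho: "0 \<le> \<rho>" "\<rho>\<^sup>2 = (cmod a)\<^sup>2 + (cmod b)\<^sup>2" by (auto simp: \<rho>_def)
  have st: "(1 - h)\<^sup>2 * \<rho>\<^sup>2 \<le> s + t" "s + t \<le> (1 + h)\<^sup>2 * \<rho>\<^sup>2"
    using s t by (auto simp: rho distrib_left)
  have st0: "0 \<le> (1 - h)\<^sup>2 * \<rho>\<^sup>2" "0 \<le> s + t"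
    using st(1) order_trans[of 0 "(1 - h)\<^sup>2 * \<rho>\<^sup>2"] by auto
  define y where "y = (s + t) * (1 + d)"
  have h2: "h * h \<le> 1 / 1000 * h" "h * h * h \<le> 1 / 1000 * h"
    using h_small h_nonneg mult_mono[of h "1/1000" h h] mult_mono[of "h * h" "1/1000" h h]
      mult_mono[of h "1/1000" h 1] by auto
  have h3: "h * (h * h) \<le> h + h * h"
    using h2 h_nonneg zero_le_square[of h] by linarith
  \<comment> \<open>Three roundings precede the square root. Enclosing the third powers of
    \<open>1 - h\<close> and \<open>1 + h\<close> by squares makes the root linear in
    \<open>h\<close>.\<close>
  have "(1 - 2 * h)\<^sup>2 \<le> (1 - h)\<^sup>2 * (1 - h)"
    using h2 h_nonneg by (simp add: power2_eq_square algebra_simps)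
  hence "((1 - 2 * h) * \<rho>)\<^sup>2 \<le> (1 - h)\<^sup>2 * (1 - h) * \<rho>\<^sup>2"
    by (simp add: power_mult_distrib mult_right_mono)
  also have "\<dots> = (1 - h)\<^sup>2 * \<rho>\<^sup>2 * (1 - h)" by simp
  also have "\<dots> \<le> y"
    unfolding y_def using st st0 d h_small by (intro mult_mono) auto
  finally have y1: "((1 - 2 * h) * \<rho>)\<^sup>2 \<le> y" .
  have "y \<le> (1 + h)\<^sup>2 * \<rho>\<^sup>2 * (1 + h)"
    unfolding y_def using st st0 d h_small by (intro mult_mono) auto
  also have "\<dots> = (1 + h)\<^sup>2 * (1 + h) * \<rho>\<^sup>2" by simp
  also have "(1 + h)\<^sup>2 * (1 + h) \<le> (1 + 2 * h)\<^sup>2"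
    using h3 by (simp add: power2_eq_square algebra_simps)
  finally have y2: "y \<le> ((1 + 2 * h) * \<rho>)\<^sup>2"
    by (simp add: power_mult_distrib mult_right_mono)
  have y0: "0 \<le> y" using y1 zero_le_power2 order_trans by blast
  have q: "(1 - 2 * h) * \<rho> \<le> sqrt y" "sqrt y \<le> (1 + 2 * h) * \<rho>"
    using y1 y2 rho h_nonneg h_small by (auto intro!: real_le_rsqrt real_le_lsqrt)
  obtain f where f: "\<bar>f\<bar> \<le> h" "fsqrt fl y = sqrt y * (1 + f)"
    using sqrt_ex[OF y0] by blast
  have "(1 - 2 * h) * \<rho> * (1 - h) \<le> sqrt y * (1 + f)"
    using q f y0 h_small by (intro mult_mono) auto
  moreover have "sqrt y * (1 + f) \<le> (1 + 2 * h) * \<rho> * (1 + h)"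
    using q f y0 h_small h_nonneg rho by (intro mult_mono) auto
  moreover have "h * h * \<rho> \<le> 1 / 1000 * h * \<rho>" "0 \<le> h * h * \<rho>" "0 \<le> h * \<rho>"
    using mult_right_mono[OF h2(1) rho(1)] rho h_nonneg by simp_all
  ultimately have "\<bar>fsqrt fl y - \<rho>\<bar> \<le> 4 * h * \<rho>"
    unfolding f by (simp add: algebra_simps abs_le_iff)
  moreover have "givens_norm fl a b = complex_of_real (fsqrt fl y)"
    by (simp add: givens_norm_def s t d y_def del: of_real_mult of_real_add)
  ultimately show thesis using that by blast
qed

text \<open>The error of \<open>r\<close> contributes at most \<open>8 * h\<close>, since
  \<open>r\<close> is at least \<open>996 / 1000 * \<rho>\<close>; the division itself contributes
  at most \<open>2 * h\<close>, since the quotient has modulus at most 2.\<close>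

lemma div_norm_approx:
  assumes "\<bar>r - \<rho>\<bar> \<le> 4 * h * \<rho>" "0 < \<rho>" "cmod a \<le> \<rho>"
  shows "cmod (fdiv fl a (complex_of_real r) - a / complex_of_real \<rho>) \<le> 10 * h"
proof -
  have hr: "h * \<rho> \<le> 1 / 1000 * \<rho>" using h_small assms(2) by (intro mult_right_mono) auto
  have r: "996 / 1000 * \<rho> \<le> r" using assms(1) hr by (simp add: abs_le_iff)
  hence r0: "0 < r" using assms(2) by linarith
  have "cmod (a / r) = cmod a / r" using r0 by (simp add: norm_divide)
  also have "\<dots> \<le> 2" using assms(2,3) r r0 by (simp add: field_simps)
  finally have 1: "cmod (fdiv fl a r - a / r) \<le> h * 2"
    using div_err[of r a] r0 mult_left_mono[OF _ h_nonneg] order_trans by fastforce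
  have "a / r - a / \<rho> = (a / \<rho>) * complex_of_real ((\<rho> - r) / r)"
    using r0 assms(2) by (simp add: field_simps)
  hence "cmod (a / r - a / \<rho>) = cmod a / \<rho> * (\<bar>r - \<rho>\<bar> / r)"
    using r0 assms(2) by (simp add: norm_mult norm_divide abs_minus_commute del: of_real_diff of_real_divide)
  also have "\<dots> \<le> 1 * (8 * h)"
  proof (intro mult_mono)
    show "cmod a / \<rho> \<le> 1" using assms by simp
    have "h * \<rho> \<le> h * (2 * r)"
      using r r0 by (intro mult_left_mono h_nonneg) simp
    hence "\<bar>r - \<rho>\<bar> \<le> 8 * h * r" using assms(1) r0 mult_nonneg_nonneg[OF h_nonneg, of r]
      by (simp add: algebra_simps)
    thus "\<bar>r - \<rho>\<bar> / r \<le> 8 * h" using r0 by (simp add: field_simps)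
  qed (use r0 in auto)
  finally have "cmod (a / r - a / \<rho>) \<le> 8 * h" by simp
  thus ?thesis using 1 norm_triangle_ineq[of "fdiv fl a r - a / r" "a / r - a / \<rho>"] by simp
qed

text \<open>The witness is the exact rotation for the same \<open>a\<close> and \<open>b\<close>.
  The last two conclusions describe the two components of its adjoint applied to
  \<open>(a, b)\<close>; they justify overwriting this pair by the computed norm and zero.\<close>

lemma givens_approx:
  fixes a b :: complex
  obtains c s where "near_rot h (givens fl k a b) (k, c, s)" "(cmod c)\<^sup>2 + (cmod s)\<^sup>2 = 1"
    "cmod (givens_norm fl a b - (cnj c * a + cnj s * b)) \<le> 4 * h * cmod (cnj c * a + cnj s * b)"
    "c * b - s * a = 0"
proof (cases "a = 0 \<and> b = 0")
  case True
  \<comment> \<open>A relative error of zero is zero, so the computed norm vanishes exactly, and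
    \<open>givens\<close> returns the identity rotation.\<close>
  obtain r where "givens_norm fl a b = complex_of_real r" "\<bar>r\<bar> \<le> 0"
    using givens_norm_approx[of a b] True by auto
  thus thesis using that[of 1 0] True h_nonneg by (simp add: givens_def)
next
  case False
  define \<rho> where "\<rho> = sqrt ((cmod a)\<^sup>2 + (cmod b)\<^sup>2)"
  have rho2: "\<rho>\<^sup>2 = (cmod a)\<^sup>2 + (cmod b)\<^sup>2" by (simp add: \<rho>_def)
  have rho: "0 < \<rho>" using False
    by (auto simp: \<rho>_def add_pos_nonneg add_nonneg_pos)
  obtain r where r: "givens_norm fl a b = complex_of_real r" "\<bar>r - \<rho>\<bar> \<le> 4 * h * \<rho>"
    unfolding \<rho>_def by (rule givens_norm_approx)
  have le: "cmod a \<le> \<rho>" "cmod b \<le> \<rho>" by (auto simp: \<rho>_def intro!: real_le_rsqrt)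
  let ?c = "a / complex_of_real \<rho>" and ?s = "b / complex_of_real \<rho>"
  have "cnj ?c * a + cnj ?s * b = (a * cnj a + b * cnj b) / complex_of_real \<rho>"
    by (simp add: add_divide_distrib mult.commute)
  also have "a * cnj a + b * cnj b = complex_of_real (\<rho>\<^sup>2)"
    by (simp add: rho2 complex_norm_square del: of_real_power)
  finally have e: "cnj ?c * a + cnj ?s * b = complex_of_real \<rho>"
    using rho by (simp add: power2_eq_square)
  show thesis
  proof (rule that[of ?c ?s])
    show "near_rot h (givens fl k a b) (k, ?c, ?s)"
      using div_norm_approx[OF r(2) rho] le False by (auto simp: givens_def r(1))
    show "(cmod ?c)\<^sup>2 + (cmod ?s)\<^sup>2 = 1"
      using rho by (simp add: norm_divide power_divide add_divide_distrib[symmetric] rho2[symmetric])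
    show "cmod (givens_norm fl a b - (cnj ?c * a + cnj ?s * b)) \<le> 4 * h * cmod (cnj ?c * a + cnj ?s * b)"
      unfolding e r(1) using r(2) rho by (simp add: of_real_diff[symmetric] del: of_real_diff)
  qed (simp add: field_simps)
qed

end

section \<open>Rounded and exact rotations of matrices\<close>

definition rotmat :: "nat \<Rightarrow> rot \<Rightarrow> complex mat" where
  "rotmat n = (\<lambda>(k, c, s). mat n n (\<lambda>(i, j).
     if i = k \<and> j = k then c else if i = k \<and> j = Suc k then - cnj s
     else if i = Suc k \<and> j = k then s else if i = Suc k \<and> j = Suc k then cnj c
     else if i = j then 1 else 0))"

lemma rotmat_carrier [simp]: "rotmat n G \<in> carrier_mat n n"
  by (simp add: rotmat_def split: prod.split)

lemma rotmat_left:
  assumes "X \<in> carrier_mat n m" "Suc k < n" "i < n" "j < m"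
  shows "(adj (rotmat n (k, c, s)) * X) $$ (i, j) =
    (if i = k then cnj c * X $$ (k, j) + cnj s * X $$ (Suc k, j)
     else if i = Suc k then c * X $$ (Suc k, j) - s * X $$ (k, j) else X $$ (i, j))"
proof -
  let ?f = "\<lambda>l. cnj (rotmat n (k, c, s) $$ (l, i)) * X $$ (l, j)"
  have "(adj (rotmat n (k, c, s)) * X) $$ (i, j) = (\<Sum>l<n. ?f l)"
    using assms by (simp add: scalar_prod_def lessThan_atLeast0 carrier_matD[OF rotmat_carrier])
  also have "\<dots> = (if i = k then cnj c * X $$ (k, j) + cnj s * X $$ (Suc k, j)
     else if i = Suc k then c * X $$ (Suc k, j) - s * X $$ (k, j) else X $$ (i, j))"
  proof (cases "i = k \<or> i = Suc k")
    case True
    hence "(\<Sum>l<n. ?f l) = (\<Sum>l\<in>{k, Suc k}. ?f l)"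
      using assms by (intro sum.mono_neutral_right) (auto simp: rotmat_def)
    hence "(\<Sum>l<n. ?f l) = ?f k + ?f (Suc k)" by simp
    moreover have "?f k + ?f (Suc k) = (if i = k then cnj c * X $$ (k, j) + cnj s * X $$ (Suc k, j)
        else c * X $$ (Suc k, j) - s * X $$ (k, j))"
      using True assms by (auto simp: rotmat_def)
    ultimately show ?thesis using True by argo
  next
    case False
    hence "(\<Sum>l<n. ?f l) = (\<Sum>l\<in>{i}. ?f l)"
      using assms by (intro sum.mono_neutral_right) (auto simp: rotmat_def)
    hence "(\<Sum>l<n. ?f l) = ?f i" by simp
    moreover have "?f i = X $$ (i, j)" using False assms by (simp add: rotmat_def)
    ultimately show ?thesis using False by argo
  qed
  finally show ?thesis .
qed

lemma rotmat_right:
  assumes "X \<in> carrier_mat m n" "Suc k < n" "i < m" "j < n"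
  shows "(X * rotmat n (k, c, s)) $$ (i, j) =
    (if j = k then c * X $$ (i, k) + s * X $$ (i, Suc k)
     else if j = Suc k then cnj c * X $$ (i, Suc k) - cnj s * X $$ (i, k) else X $$ (i, j))"
proof -
  have "X * rotmat n (k, c, s) = adj (adj (rotmat n (k, c, s)) * adj X)"
    using assms by (subst adj_mult[of _ n n _ m]) simp_all
  thus ?thesis
    using assms rotmat_left[of "adj X" n m k j i c s]
    by (simp del: index_mult_mat(1) add: carrier_matD[OF rotmat_carrier])
qed

lemma rotmat_unitary:
  assumes "unit_rot n G"
  shows "unitary n (rotmat n G)"
proof -
  obtain k c s where G: "G = (k, c, s)" by (cases G)
  have "complex_of_real ((cmod c)\<^sup>2 + (cmod s)\<^sup>2) = 1" using assms G by simp
  hence e: "c * cnj c + s * cnj s = 1"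
    by (simp add: complex_norm_square del: of_real_power)
  have "adj (rotmat n G) * rotmat n G = 1\<^sub>m n"
  proof (rule eq_matI)
    fix i j assume "i < dim_row (1\<^sub>m n :: complex mat)" "j < dim_col (1\<^sub>m n :: complex mat)"
    thus "(adj (rotmat n G) * rotmat n G) $$ (i, j) = 1\<^sub>m n $$ (i, j)"
      using assms e unfolding G
      by (subst rotmat_left[of _ n n]) (auto simp: rotmat_def algebra_simps)
  qed (simp_all add: carrier_matD[OF rotmat_carrier])
  thus ?thesis by (simp add: unitary_def)
qed

text \<open>Factors stand in list order, so that the adjoint applies the first rotation of the list
  first, as \<open>fold\<close> does.\<close>

fun rotprod :: "nat \<Rightarrow> rot list \<Rightarrow> complex mat" where
  "rotprod n [] = 1\<^sub>m n"
| "rotprod n (G # Gs) = rotmat n G * rotprod n Gs"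

lemma rotprod_unitary: "\<forall>G\<in>set Gs. unit_rot n G \<Longrightarrow> unitary n (rotprod n Gs)"
  by (induction Gs) (auto simp: unitary_one unitary_mult rotmat_unitary)

lemma rotprod_carrier [simp]: "rotprod n Gs \<in> carrier_mat n n"
  by (induction Gs) (auto intro: mult_carrier_mat[of _ n n])

text \<open>Vectors become one-column matrices so that the Frobenius norm and the row rotation
  lemmas also cover the generators \<open>u\<close> and \<open>v\<close>.\<close>

definition colvec :: "nat \<Rightarrow> (nat \<Rightarrow> complex) \<Rightarrow> complex mat" where
  "colvec n x = mat n 1 (\<lambda>(i, j). x i)"

lemma colvec_carrier [simp]: "colvec n x \<in> carrier_mat n 1" "colvec n x \<in> carrier_mat n (Suc 0)"
  by (simp_all add: colvec_def)

lemma colvec_entry: "i < n \<Longrightarrow> cmod (x i) \<le> fro (colvec n x)"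
  using fro_entry[of "colvec n x" n 1 i 0] by (simp add: colvec_def)

lemma gmat_carrier [simp]: "gmat n g \<in> carrier_mat n n"
  by (simp add: gmat_def)

lemma gmat_lower: "i < n \<Longrightarrow> j \<le> i \<Longrightarrow> gmat n g $$ (i, j) = lower g i j"
  by (simp add: gmat_def entry_def)

lemma lower_le_fro: "i < n \<Longrightarrow> j \<le> i \<Longrightarrow> cmod (lower g i j) \<le> fro (gmat n g)"
  using fro_entry[of "gmat n g" n n i j] by (simp add: gmat_lower)

text \<open>The size condition for analysing one update, with a factor 2 of slack over the initial
  sizes. The scale \<open>S\<close> belongs to the matrix and to \<open>v\<close>, whereas
  \<open>u\<close> starts as a unit vector.\<close>

definition bounded :: "nat \<Rightarrow> real \<Rightarrow> gens \<Rightarrow> bool" where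
  "bounded n S g \<longleftrightarrow> fro (gmat n g) \<le> 2 * S \<and> fro (colvec n (gu g)) \<le> 2 \<and>
     fro (colvec n (gv g)) \<le> 2 * S"

lemma bounded_nonneg: "bounded n S g \<Longrightarrow> 0 \<le> S"
  using fro_nonneg[of "gmat n g"] unfolding bounded_def by linarith

lemma fold_vec_rot:
  "fold (row_rot fl) Gs (\<lambda>i j. x i) = (\<lambda>i j. fold (vec_rot fl) Gs x i)"
proof (induction Gs arbitrary: x)
  case (Cons G Gs)
  have "row_rot fl G (\<lambda>i j. x i) = (\<lambda>i j. vec_rot fl G x i)"
    by (simp add: row_rot_def)
  thus ?case using Cons.IH[of "vec_rot fl G x"] by simp
qed simp

context rounding
begin

text \<open>One component of a rotated pair costs two products and one sum: each product raises the
  error to at most \<open>3 / 2 * e\<close>, and the sum of both to at most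
  \<open>4 * e\<close>.\<close>

lemma comb_approx:
  assumes "cmod (c - c') \<le> 10 * h" "cmod (s - s') \<le> 10 * h" "cmod c' \<le> 1" "cmod s' \<le> 1"
    and "cmod (x - x') \<le> e" "cmod (y - y') \<le> e" "cmod x' \<le> b" "cmod y' \<le> b" "30 * h * b \<le> e"
  shows "cmod (fadd fl (fmul fl c x) (fmul fl s y) - (c' * x' + s' * y')) \<le> 4 * e"
    and "cmod (fsub fl (fmul fl c x) (fmul fl s y) - (c' * x' - s' * y')) \<le> 4 * e"
    and "cmod (fadd fl (fmul fl x c) (fmul fl y s) - (c' * x' + s' * y')) \<le> 4 * e"
    and "cmod (fsub fl (fmul fl x c) (fmul fl y s) - (c' * x' - s' * y')) \<le> 4 * e"
proof -
  have e: "0 \<le> e" using assms(5) norm_ge_zero order_trans by blast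
  have b: "cmod (c' * x') \<le> b" "cmod (s' * y') \<le> b"
    using assms mult_mono[of "cmod c'" 1 "cmod x'" b] mult_mono[of "cmod s'" 1 "cmod y'" b]
    by (auto simp: norm_mult)
  note p = mul_approx[OF assms(1,3,5,7,9)] mul_approx[OF assms(2,4,6,8,9)]
  note p' = mul_approx'[OF assms(1,3,5,7,9)] mul_approx'[OF assms(2,4,6,8,9)]
  note le = combine_le[OF e assms(9)]
  show "cmod (fadd fl (fmul fl c x) (fmul fl s y) - (c' * x' + s' * y')) \<le> 4 * e"
    using order_trans[OF add_approx[OF p b] le] .
  show "cmod (fsub fl (fmul fl c x) (fmul fl s y) - (c' * x' - s' * y')) \<le> 4 * e"
    using order_trans[OF sub_approx[OF p b] le] .
  show "cmod (fadd fl (fmul fl x c) (fmul fl y s) - (c' * x' + s' * y')) \<le> 4 * e"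
    using order_trans[OF add_approx[OF p' b] le] .
  show "cmod (fsub fl (fmul fl x c) (fmul fl y s) - (c' * x' - s' * y')) \<le> 4 * e"
    using order_trans[OF sub_approx[OF p' b] le] .
qed

lemma unit_rot_le:
  assumes "unit_rot n (k, c, s)"
  shows "cmod c \<le> 1" "cmod s \<le> 1"
proof -
  have "(cmod c)\<^sup>2 \<le> 1\<^sup>2" "(cmod s)\<^sup>2 \<le> 1\<^sup>2"
    using assms zero_le_power2[of "cmod s"] zero_le_power2[of "cmod c"]
    unfolding unit_rot.simps one_power2 by linarith+
  thus "cmod c \<le> 1" "cmod s \<le> 1" by (auto intro: power2_le_imp_le)
qed

lemma row_rot_near:
  assumes "near n m e M X" "X \<in> carrier_mat n m" "fro X \<le> b" "30 * h * b \<le> e" "0 \<le> e"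
    and "near_rot h G G'" "unit_rot n G'"
  shows "near n m (4 * e) (row_rot fl G M) (adj (rotmat n G') * X)"
proof -
  obtain k c s c' s' where G: "G = (k, c, s)" "G' = (k, c', s')"
    using assms(6) by (cases G; cases G') auto
  have k: "Suc k < n" using assms(7) G by simp
  have u: "cmod c' \<le> 1" "cmod s' \<le> 1" using unit_rot_le assms(7) G by auto
  have d: "cmod (c - c') \<le> 10 * h" "cmod (s - s') \<le> 10 * h" using assms(6) G by auto
  have d': "cmod (cnj c - cnj c') \<le> 10 * h" "cmod (cnj s - cnj s') \<le> 10 * h"
    using d by (metis complex_cnj_diff complex_mod_cnj)+
  show ?thesis unfolding near_def
  proof (intro allI impI)
    fix i j assume ij: "i < n" "j < m"
    have n: "cmod (M l j - X $$ (l, j)) \<le> e" "cmod (X $$ (l, j)) \<le> b" if "l < n" for l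
      using assms(1,3) fro_entry[OF assms(2) that ij(2)] that ij by (auto simp: near_def)
    show "cmod (row_rot fl G M i j - (adj (rotmat n G') * X) $$ (i, j)) \<le> 4 * e"
      unfolding G rotmat_left[OF assms(2) k ij]
      using comb_approx(1)[OF d' _ _ n(1)[of k] n(1)[of "Suc k"] n(2)[of k] n(2)[of "Suc k"] assms(4)]
        comb_approx(2)[OF d u n(1)[of "Suc k"] n(1)[of k] n(2)[of "Suc k"] n(2)[of k] assms(4)]
        n(1)[of i] u k ij assms(5)
      by (auto simp: row_rot_def)
  qed
qed

lemma col_rot_near:
  assumes "near m n e M X" "X \<in> carrier_mat m n" "fro X \<le> b" "30 * h * b \<le> e" "0 \<le> e"
    and "near_rot h G G'" "unit_rot n G'"
  shows "near m n (4 * e) (col_rot fl G M) (X * rotmat n G')"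
proof -
  obtain k c s c' s' where G: "G = (k, c, s)" "G' = (k, c', s')"
    using assms(6) by (cases G; cases G') auto
  have k: "Suc k < n" using assms(7) G by simp
  have u: "cmod c' \<le> 1" "cmod s' \<le> 1" using unit_rot_le assms(7) G by auto
  have d: "cmod (c - c') \<le> 10 * h" "cmod (s - s') \<le> 10 * h" using assms(6) G by auto
  have d': "cmod (cnj c - cnj c') \<le> 10 * h" "cmod (cnj s - cnj s') \<le> 10 * h"
    using d by (metis complex_cnj_diff complex_mod_cnj)+
  show ?thesis unfolding near_def
  proof (intro allI impI)
    fix i j assume ij: "i < m" "j < n"
    have n: "cmod (M i l - X $$ (i, l)) \<le> e" "cmod (X $$ (i, l)) \<le> b" if "l < n" for l
      using assms(1,3) fro_entry[OF assms(2) ij(1) that] that ij by (auto simp: near_def)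
    show "cmod (col_rot fl G M i j - (X * rotmat n G') $$ (i, j)) \<le> 4 * e"
      unfolding G rotmat_right[OF assms(2) k ij]
      using comb_approx(3)[OF d u n(1)[of k] n(1)[of "Suc k"] n(2)[of k] n(2)[of "Suc k"] assms(4)]
        comb_approx(4)[OF d' _ _ n(1)[of "Suc k"] n(1)[of k] n(2)[of "Suc k"] n(2)[of k] assms(4)]
        n(1)[of j] u k ij assms(5)
      by auto
  qed
qed

text \<open>The exact rotations preserve the Frobenius norm, so the same \<open>b\<close> serves
  throughout. The factor 4 per rotation is harmless because an update uses at most two
  rotations.\<close>

lemma rows_near:
  assumes "list_all2 (near_rot h) Gs Gs'" "\<forall>G\<in>set Gs'. unit_rot n G"
    and "near n m e M X" "X \<in> carrier_mat n m" "fro X \<le> b" "30 * h * b \<le> e" "0 \<le> e"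
  shows "near n m (4 ^ length Gs * e) (fold (row_rot fl) Gs M) (adj (rotprod n Gs') * X)"
  using assms
proof (induction arbitrary: e M X rule: list_all2_induct)
  case Nil
  have "adj (1\<^sub>m n) = 1\<^sub>m n" by (rule eq_matI) auto
  thus ?case using Nil by simp
next
  case (Cons G Gs G' Gs')
  let ?X = "adj (rotmat n G') * X"
  have e4: "30 * h * b \<le> 4 * e" "0 \<le> 4 * e" using Cons.prems by linarith+
  have "near n m (4 * e) (row_rot fl G M) ?X"
    using Cons.prems Cons.hyps by (intro row_rot_near) auto
  hence "near n m (4 ^ length Gs * (4 * e)) (fold (row_rot fl) Gs (row_rot fl G M))
      (adj (rotprod n Gs') * ?X)"
    using Cons.prems fro_unitary_left[OF unitary_adj[OF rotmat_unitary[of n G']] Cons.prems(3)]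
    by (intro Cons.IH[OF _ _ _ _ e4]) (auto intro: mult_carrier_mat[of _ n n])
  moreover have "adj (rotprod n Gs') * ?X = adj (rotprod n (G' # Gs')) * X"
    using Cons.prems
    by (simp add: adj_mult[of _ n n _ n] assoc_mult_mat[of _ n n _ n _ m])
  ultimately show ?case by (simp add: ac_simps)
qed

lemma cols_near:
  assumes "list_all2 (near_rot h) Gs Gs'" "\<forall>G\<in>set Gs'. unit_rot n G"
    and "near m n e M X" "X \<in> carrier_mat m n" "fro X \<le> b" "30 * h * b \<le> e" "0 \<le> e"
  shows "near m n (4 ^ length Gs * e) (fold (col_rot fl) Gs M) (X * rotprod n Gs')"
  using assms
proof (induction arbitrary: e M X rule: list_all2_induct)
  case Nil
  thus ?case by simp
next
  case (Cons G Gs G' Gs')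
  let ?X = "X * rotmat n G'"
  have e4: "30 * h * b \<le> 4 * e" "0 \<le> 4 * e" using Cons.prems by linarith+
  have "near m n (4 * e) (col_rot fl G M) ?X"
    using Cons.prems Cons.hyps by (intro col_rot_near) auto
  hence "near m n (4 ^ length Gs * (4 * e)) (fold (col_rot fl) Gs (col_rot fl G M))
      (?X * rotprod n Gs')"
    using Cons.prems fro_unitary_right[OF rotmat_unitary[of n G'] Cons.prems(3)]
    by (intro Cons.IH[OF _ _ _ _ e4]) (auto intro: mult_carrier_mat[of _ m n])
  moreover have "?X * rotprod n Gs' = X * rotprod n (G' # Gs')"
    using Cons.prems by (simp add: assoc_mult_mat[of _ m n _ n _ n])
  ultimately show ?case by (simp add: ac_simps)
qed

text \<open>Cancellation rules out a small relative error, but all intermediate quantities are of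
  order \<open>S\<close>. The error stays near \<open>50 * h * S\<close>; stating it as
  \<open>100 * h * S\<close> makes it dominate \<open>30 * h * (2 * S)\<close>, as
  \<open>rows_near\<close> demands of its initial error.\<close>

lemma fentry_near:
  assumes "bounded n S g"
  shows "near n n (100 * h * S) (fentry fl g) (gmat n g)"
  unfolding near_def
proof (intro allI impI)
  fix i j assume ij: "i < n" "j < n"
  have S: "0 \<le> S" using assms by (rule bounded_nonneg)
  have hS: "0 \<le> h * S" using S h_nonneg by simp
  show "cmod (fentry fl g i j - gmat n g $$ (i, j)) \<le> 100 * h * S"
  proof (cases "j \<le> i")
    case True
    thus ?thesis using ij hS by (simp add: gmat_lower fentry_def ac_simps)
  next
    case False
    have u: "cmod (gu g k) \<le> 2" and v: "cmod (gv g k) \<le> 2 * S" if "k < n" for k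
      using colvec_entry[OF that, of "gu g"] colvec_entry[OF that, of "gv g"] assms
      by (auto simp: bounded_def)
    have l: "cmod (cnj (lower g j i)) \<le> 4 * S"
      using lower_le_fro[of j n i g] ij False assms S by (simp add: bounded_def)
    have p: "cmod (cnj (gu g j) * gv g i) \<le> 4 * S" "cmod (gu g i * cnj (gv g j)) \<le> 4 * S"
      using mult_mono[OF u v, of j i] mult_mono[OF u v, of i j] ij S by (auto simp: norm_mult)
    have e: "cmod (fmul fl x y - x * y) \<le> 4 * h * S" if "cmod (x * y) \<le> 4 * S" for x y
      using mul_err[of x y] mult_left_mono[OF that h_nonneg] by simp
    let ?w = "cnj (lower g j i) - cnj (gu g j) * gv g i"
    have hh: "h * (h * S) \<le> 1 / 1000 * (h * S)"
      using h_small hS by (intro mult_right_mono)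
    have "cmod (fsub fl (cnj (lower g j i)) (fmul fl (cnj (gu g j)) (gv g i)) - ?w)
        \<le> 2 * (4 * h * S) + h * (2 * (4 * S) + 2 * (4 * h * S))"
      by (rule sub_approx) (use e[OF p(1)] l p hS in \<open>auto simp: ac_simps\<close>)
    also have "\<dots> \<le> 17 * h * S" using hh hS by (simp add: algebra_simps)
    finally have w: "cmod (fsub fl (cnj (lower g j i)) (fmul fl (cnj (gu g j)) (gv g i)) - ?w) \<le> 17 * h * S" .
    have w': "cmod ?w \<le> 8 * S"
      using norm_triangle_ineq4[of "cnj (lower g j i)" "cnj (gu g j) * gv g i"] l p by linarith
    have "cmod (fentry fl g i j - (?w + gu g i * cnj (gv g j)))
        \<le> 2 * (17 * h * S) + h * (2 * (8 * S) + 2 * (17 * h * S))"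
      unfolding fentry_def if_not_P[OF False]
    proof (rule add_approx)
      show "cmod (fmul fl (gu g i) (cnj (gv g j)) - gu g i * cnj (gv g j)) \<le> 17 * h * S"
        using e[OF p(2)] hS by linarith
      show "cmod (gu g i * cnj (gv g j)) \<le> 8 * S" using p S by linarith
    qed (use w w' in auto)
    also have "\<dots> \<le> 100 * h * S" using hh hS by (simp add: algebra_simps)
    finally show ?thesis using False ij by (simp add: gmat_def entry_def)
  qed
qed

end

section \<open>Backward error of one update\<close>

text \<open>Only the lower triangle of \<open>M\<close> is stored in \<open>g'\<close>; its upper triangle is a free choice,
  so that \<open>M\<close> can be taken close to the conjugated matrix even where the symmetry formula
  for \<open>g'\<close> is not accurate. The scale \<open>S\<close> stays fixed during the whole iteration.\<close>
definition step :: "nat \<Rightarrow> real \<Rightarrow> real \<Rightarrow> gens \<Rightarrow> gens \<Rightarrow> bool" where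
  "step n E S g g' \<longleftrightarrow> (\<exists>Q M. unitary n Q \<and> M \<in> carrier_mat n n \<and>
     (\<forall>i<n. \<forall>j\<le>i. lower g' i j = M $$ (i, j)) \<and>
     fro (M - adj Q * gmat n g * Q) \<le> E * S \<and>
     fro (colvec n (gu g') - adj Q * colvec n (gu g)) \<le> E \<and>
     fro (colvec n (gv g') - adj Q * colvec n (gv g)) \<le> E * S)"

lemma lower_set_lower: "j \<le> i \<Longrightarrow> lower (set_lower M g) i j = M i j"
  by (auto simp: lower_def set_lower_def)

lemma set_lower_simps [simp]: "gu (set_lower M g) = gu g" "gv (set_lower M g) = gv g"
  by (simp_all add: set_lower_def)

lemma lower_update [simp]: "lower (g\<lparr>gu := u, gv := v\<rparr>) = lower g"
  by (intro ext) (simp add: lower_def)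

lemma adj_one [simp]: "adj (1\<^sub>m n) = 1\<^sub>m n"
  by (rule eq_matI) auto

lemma near_colvec:
  assumes "near n 1 e (\<lambda>i j. x i) Y" "Y \<in> carrier_mat n 1" "0 < n" "0 \<le> e"
  shows "fro (colvec n x - Y) \<le> real n * e"
proof (rule fro_le_max)
  show "colvec n x - Y \<in> carrier_mat n 1" using assms by (simp add: minus_carrier_mat)
  show "cmod ((colvec n x - Y) $$ (i, j)) \<le> e" if "i < n" "j < 1" for i j
    using assms that by (auto simp: near_def colvec_def)
qed (use assms in auto)

text \<open>The witness takes its lower triangle from \<open>g'\<close> and its upper triangle from
  the exact conjugate, so only the stored entries have to be compared.\<close>

lemma stepI:
  assumes "unitary n Q" "0 < n" "0 \<le> e" "0 \<le> S" "real n * e \<le> E"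
    and "\<And>i j. i < n \<Longrightarrow> j \<le> i \<Longrightarrow> cmod (lower g' i j - (adj Q * gmat n g * Q) $$ (i, j)) \<le> e * S"
    and "near n 1 e (\<lambda>i j. gu g' i) (adj Q * colvec n (gu g))"
    and "near n 1 (e * S) (\<lambda>i j. gv g' i) (adj Q * colvec n (gv g))"
  shows "step n E S g g'"
proof -
  let ?X = "adj Q * gmat n g * Q"
  have Q: "Q \<in> carrier_mat n n" using assms(1) by (rule unitary_carrier)
  have X: "?X \<in> carrier_mat n n"
    using Q by (auto intro!: mult_carrier_mat[of _ n n])
  have Y: "adj Q * colvec n x \<in> carrier_mat n 1" for x
    using Q by (auto intro!: mult_carrier_mat[of _ n n])
  define M where "M = mat n n (\<lambda>(i, j). if j \<le> i then lower g' i j else ?X $$ (i, j))"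
  have nS: "real n * (e * S) \<le> E * S"
    using mult_right_mono[OF assms(5,4)] by simp
  have "fro (M - ?X) \<le> real n * (e * S)"
  proof (rule fro_le_max)
    show "M - ?X \<in> carrier_mat n n" using X by (simp add: minus_carrier_mat)
    show "cmod ((M - ?X) $$ (i, j)) \<le> e * S" if "i < n" "j < n" for i j
      using assms(3,4,6) X that by (auto simp: M_def)
  qed (use assms in auto)
  moreover have "fro (colvec n (gu g') - adj Q * colvec n (gu g)) \<le> real n * e"
    using assms Y by (intro near_colvec) auto
  moreover have "fro (colvec n (gv g') - adj Q * colvec n (gv g)) \<le> real n * (e * S)"
    using assms Y by (intro near_colvec) auto
  ultimately show ?thesis unfolding step_def
    using nS assms(1,5) by (intro exI[of _ Q] exI[of _ M]) (auto simp: M_def)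
qed

text \<open>With the identity as unitary factor this covers deflation and the dropping of spike
  entries.\<close>

lemma step_perturb:
  assumes "0 < n" "0 \<le> e" "0 \<le> S" "real n * e \<le> E"
    and "\<And>i j. i < n \<Longrightarrow> j \<le> i \<Longrightarrow> cmod (lower g' i j - lower g i j) \<le> e * S"
    and "gu g' = gu g" "gv g' = gv g"
  shows "step n E S g g'"
proof (rule stepI[of n "1\<^sub>m n" e])
  show "cmod (lower g' i j - (adj (1\<^sub>m n) * gmat n g * 1\<^sub>m n) $$ (i, j)) \<le> e * S"
    if "i < n" "j \<le> i" for i j
    using assms(5)[OF that] that
    by (simp add: right_mult_one_mat[of _ n n] left_mult_one_mat[of _ n n] gmat_lower)
qed (use assms in \<open>auto simp: near_def colvec_def left_mult_one_mat[of _ n 1] unitary_one\<close>)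

section \<open>The updates of the algorithm as backward stable steps\<close>

context rounding
begin

text \<open>The constant is \<open>16 * 16 * 100\<close>: \<open>fentry_near\<close> gives 100, and
  up to two rotations from the left and as many from the right multiply it by 16 each time. For
  \<open>u\<close> and \<open>v\<close> only one factor 16 arises.\<close>

lemma similarity_near:
  assumes "bounded n S g" "list_all2 (near_rot h) Gs Gs'" "\<forall>G\<in>set Gs'. unit_rot n G" "length Gs \<le> 2"
  shows "i < n \<Longrightarrow> j \<le> i \<Longrightarrow> cmod (lower (similarity fl Gs g) i j -
      (adj (rotprod n Gs') * gmat n g * rotprod n Gs') $$ (i, j)) \<le> 25600 * h * S"
    and "near n 1 (25600 * h) (\<lambda>i j. gu (similarity fl Gs g) i) (adj (rotprod n Gs') * colvec n (gu g))"
    and "near n 1 (25600 * h * S) (\<lambda>i j. gv (similarity fl Gs g) i) (adj (rotprod n Gs') * colvec n (gv g))"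
proof -
  have S: "0 \<le> S" using assms(1) by (rule bounded_nonneg)
  hence hS: "0 \<le> h * S" "0 \<le> S * h" using h_nonneg by simp_all
  have "(4::real) ^ length Gs \<le> 4 ^ 2" using assms(4) by (intro power_increasing) auto
  hence pw: "1 \<le> (4::real) ^ length Gs" "(4::real) ^ length Gs \<le> 16" by auto
  let ?Q = "rotprod n Gs'" and ?p = "(4::real) ^ length Gs"
  have U: "unitary n ?Q" using assms(3) by (rule rotprod_unitary)
  have b: "fro (gmat n g) \<le> 2 * S" "fro (colvec n (gu g)) \<le> 2" "fro (colvec n (gv g)) \<le> 2 * S"
    using assms(1) by (auto simp: bounded_def)
  have near_self: "near n 1 e (\<lambda>i j. x i) (colvec n x)" if "0 \<le> e" for x e
    using that by (simp add: near_def colvec_def)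
  have "near n n (?p * (100 * h * S)) (fold (row_rot fl) Gs (fentry fl g)) (adj ?Q * gmat n g)"
    using b(1) hS by (intro rows_near[OF assms(2,3) fentry_near[OF assms(1)]]) (auto simp: ac_simps)
  hence nn: "near n n (?p * (?p * (100 * h * S)))
      (fold (col_rot fl) Gs (fold (row_rot fl) Gs (fentry fl g))) (adj ?Q * gmat n g * ?Q)"
  proof (rule cols_near[OF assms(2,3)])
    show "fro (adj ?Q * gmat n g) \<le> 2 * S"
      using b(1) U by (simp add: fro_unitary_left[where n = n and m = n] unitary_adj)
    have "1 * (100 * h * S) \<le> ?p * (100 * h * S)"
      using pw hS by (intro mult_right_mono) auto
    thus "30 * h * (2 * S) \<le> ?p * (100 * h * S)" using hS by linarith
    show "0 \<le> ?p * (100 * h * S)" using h_nonneg S by simp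
  qed (use hS in \<open>auto intro!: mult_carrier_mat[of _ n n] simp: ac_simps\<close>)
  have p1: "?p * (100 * h * S) \<le> 16 * (100 * h * S)"
    using pw h_nonneg S by (intro mult_right_mono) auto
  have "?p * (?p * (100 * h * S)) \<le> 16 * (16 * (100 * h * S))"
    using h_nonneg S by (intro mult_mono[OF pw(2) p1]) auto
  hence "?p * (?p * (100 * h * S)) \<le> 25600 * h * S" by linarith
  with nn have "near n n (25600 * h * S)
      (fold (col_rot fl) Gs (fold (row_rot fl) Gs (fentry fl g))) (adj ?Q * gmat n g * ?Q)"
    by (rule near_mono)
  thus "i < n \<Longrightarrow> j \<le> i \<Longrightarrow> cmod (lower (similarity fl Gs g) i j -
      (adj ?Q * gmat n g * ?Q) $$ (i, j)) \<le> 25600 * h * S"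
    by (simp add: near_def similarity_def lower_set_lower)
  have "near n 1 (?p * (100 * h)) (fold (row_rot fl) Gs (\<lambda>i j. gu g i)) (adj ?Q * colvec n (gu g))"
    using b(2) h_nonneg by (intro rows_near[OF assms(2,3) near_self]) auto
  moreover have "?p * (100 * h) \<le> 16 * (100 * h)"
    using pw h_nonneg by (intro mult_right_mono) auto
  ultimately show "near n 1 (25600 * h) (\<lambda>i j. gu (similarity fl Gs g) i) (adj ?Q * colvec n (gu g))"
    unfolding fold_vec_rot similarity_def using h_nonneg by (auto elim!: near_mono)
  have "near n 1 (?p * (100 * h * S)) (fold (row_rot fl) Gs (\<lambda>i j. gv g i)) (adj ?Q * colvec n (gv g))"
    using b(3) hS by (intro rows_near[OF assms(2,3) near_self]) (auto simp: ac_simps)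
  moreover have "?p * (100 * h * S) \<le> 16 * (100 * h * S)"
    using pw hS by (intro mult_right_mono) auto
  ultimately show "near n 1 (25600 * h * S) (\<lambda>i j. gv (similarity fl Gs g) i) (adj ?Q * colvec n (gv g))"
    unfolding fold_vec_rot similarity_def using hS by (auto elim!: near_mono)
qed

lemma step_similarity:
  assumes "bounded n S g" "list_all2 (near_rot h) Gs Gs'" "\<forall>G\<in>set Gs'. unit_rot n G" "length Gs \<le> 2"
    and "0 < n" "real n * (25600 * h) \<le> E"
  shows "step n E S g (similarity fl Gs g)"
  using similarity_near[OF assms(1-4)] assms rotprod_unitary[OF assms(3)] bounded_nonneg[OF assms(1)] h_nonneg
  by (intro stepI[of n "rotprod n Gs'" "25600 * h"]) auto

text \<open>\<open>givens_approx\<close> holds for arbitrary arguments, so neither the shift nor the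
  rounding in its subtraction enters the error.\<close>

lemma step_single_start:
  assumes "bounded n S g" "Suc lo < n" "real n * (25600 * h) \<le> E"
  shows "step n E S g (single_start fl \<sigma> lo g)"
proof -
  obtain c s where "near_rot h (givens fl lo (fsub fl (gd g lo) \<sigma>) (gb g lo)) (lo, c, s)"
    "(cmod c)\<^sup>2 + (cmod s)\<^sup>2 = 1"
    by (rule givens_approx)
  thus ?thesis unfolding single_start_def
    using assms by (intro step_similarity[where Gs' = "[(lo, c, s)]"]) auto
qed

text \<open>Errors in the first column of the shift polynomial merely select different rotations, so
  \<open>x0\<close>, \<open>x1\<close>, \<open>x2\<close> may be arbitrary.\<close>

lemma step_double_start:
  assumes "bounded n S g" "Suc (Suc lo) < n" "real n * (25600 * h) \<le> E"
  shows "step n E S g (double_start fl \<sigma> lo g)"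
proof -
  have "step n E S g (similarity fl (givens3 fl lo x0 x1 x2) g)" for x0 x1 x2
  proof -
    obtain c s where 1: "near_rot h (givens fl (Suc lo) x1 x2) (Suc lo, c, s)"
      "(cmod c)\<^sup>2 + (cmod s)\<^sup>2 = 1"
      by (rule givens_approx)
    obtain c' s' where 2: "near_rot h (givens fl lo x0 (givens_norm fl x1 x2)) (lo, c', s')"
      "(cmod c')\<^sup>2 + (cmod s')\<^sup>2 = 1"
      by (rule givens_approx)
    show ?thesis unfolding givens3_def
      using 1 2 assms by (intro step_similarity[where Gs' = "[(Suc lo, c, s), (lo, c', s')]"]) auto
  qed
  thus ?thesis unfolding double_start_def Let_def .
qed

text \<open>Column \<open>j\<close> lies to the left of both rotated columns, so there the exact
  conjugate is the row rotation alone: it has the exact norm in row \<open>i - 1\<close> and zero in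
  row \<open>i\<close>. Overwriting these entries thus costs only the error of the computed
  norm.\<close>

lemma step_annihilate:
  assumes "bounded n S g" "i < n" "Suc j < i" "real n * (25600 * h) \<le> E"
  shows "step n E S g (annihilate fl (i, j) g)"
proof -
  define a where "a = lower g (i - 1) j"
  define b where "b = lower g i j"
  define k where "k = i - 1"
  have k: "Suc k = i" "j < k" using assms by (auto simp: k_def)
  obtain c s where r: "near_rot h (givens fl k a b) (k, c, s)" "(cmod c)\<^sup>2 + (cmod s)\<^sup>2 = 1"
    "cmod (givens_norm fl a b - (cnj c * a + cnj s * b)) \<le> 4 * h * cmod (cnj c * a + cnj s * b)"
    "c * b - s * a = 0"
    by (rule givens_approx)
  have S: "0 \<le> S" using assms(1) by (rule bounded_nonneg)
  have hS: "0 \<le> h * S" "0 \<le> S * h" using S h_nonneg by simp_all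
  let ?G = "(k, c, s)"
  have rp: "rotprod n [?G] = rotmat n ?G"
    by (simp add: right_mult_one_mat[of _ n n])
  let ?X = "adj (rotmat n ?G) * gmat n g * rotmat n ?G"
  have u: "unit_rot n ?G" using r k assms by simp
  have U: "unitary n (rotmat n ?G)" using u by (rule rotmat_unitary)
  have C: "adj (rotmat n ?G) * gmat n g \<in> carrier_mat n n" "?X \<in> carrier_mat n n"
    by (auto intro!: mult_carrier_mat[of _ n n])
  have "list_all2 (near_rot h) [givens fl k a b] [?G]" "\<forall>G\<in>set [?G]. unit_rot n G"
      "length [givens fl k a b] \<le> 2" using r u by auto
  note sn = similarity_near[OF assms(1) this, unfolded rp]
  let ?g = "similarity fl [givens fl k a b] g"
  have X: "?X $$ (l, j) = (if l = k then cnj c * a + cnj s * b else if l = i then 0 else lower g l j)"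
    if "l < n" "j \<le> l" for l
    using that k assms r(4)
    by (subst rotmat_right[OF C(1)], simp, simp, simp, subst rotmat_left[of _ n n])
      (auto simp: gmat_lower a_def b_def k_def)
  have "cmod (?X $$ (k, j)) \<le> 2 * S"
    using fro_entry[OF C(2), of k j] fro_unitary_similar[OF U, of "gmat n g"] assms k
    by (auto simp: bounded_def)
  hence "4 * h * cmod (cnj c * a + cnj s * b) \<le> 4 * h * (2 * S)"
    using X[of k] k assms h_nonneg by (intro mult_left_mono) auto
  hence norm: "cmod (givens_norm fl a b - ?X $$ (k, j)) \<le> 25600 * h * S"
  proof -
    have *: "?X $$ (k, j) = cnj c * a + cnj s * b" using X[of k] k assms by auto
    show ?thesis unfolding * using r(3) \<open>4 * h * cmod (cnj c * a + cnj s * b) \<le> 4 * h * (2 * S)\<close> hS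
      by linarith
  qed
  define g' where "g' = annihilate fl (i, j) g"
  have g': "g' = set_lower (\<lambda>k' l. if l = j \<and> k' = k then givens_norm fl a b
      else if l = j \<and> k' = i then 0 else lower ?g k' l) ?g"
    by (simp only: g'_def annihilate_def Let_def a_def b_def k_def case_prod_conv)
  have "step n E S g g'"
  proof (rule stepI[of n "rotmat n ?G" "25600 * h"])
    show "cmod (lower g' l m - ?X $$ (l, m)) \<le> 25600 * h * S" if "l < n" "m \<le> l" for l m
      using sn(1)[OF that] norm X[of l] that hS k unfolding g' lower_set_lower[OF that(2)] by auto
  qed (use U S h_nonneg sn(2,3) assms in \<open>auto simp: g'\<close>)
  thus ?thesis by (simp add: g'_def)
qed

text \<open>Column \<open>i - 1\<close> is again untouched by the column rotations. The new
  difficulty is that the second rotation is computed from the rounded norm \<open>t\<close> in place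
  of the exact value \<open>\<rho>\<close>, so the exact product annihilates row
  \<open>i + 1\<close> only up to an error of order \<open>h * S\<close>.\<close>

lemma step_double_chase:
  assumes "bounded n S g" "Suc (Suc i) < n" "0 < i" "real n * (25600 * h) \<le> E"
  shows "step n E S g (double_chase fl i g)"
proof -
  define j where "j = i - 1"
  define x0 where "x0 = lower g i j"
  define x1 where "x1 = lower g (Suc i) j"
  define x2 where "x2 = lower g (Suc (Suc i)) j"
  have j: "j < i" using assms by (simp add: j_def)
  obtain c s where r: "near_rot h (givens fl (Suc i) x1 x2) (Suc i, c, s)" "(cmod c)\<^sup>2 + (cmod s)\<^sup>2 = 1"
    "cmod (givens_norm fl x1 x2 - (cnj c * x1 + cnj s * x2)) \<le> 4 * h * cmod (cnj c * x1 + cnj s * x2)"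
    "c * x2 - s * x1 = 0"
    by (rule givens_approx)
  define \<rho> where "\<rho> = cnj c * x1 + cnj s * x2"
  define t where "t = givens_norm fl x1 x2"
  obtain c' s' where r': "near_rot h (givens fl i x0 t) (i, c', s')" "(cmod c')\<^sup>2 + (cmod s')\<^sup>2 = 1"
    "cmod (givens_norm fl x0 t - (cnj c' * x0 + cnj s' * t)) \<le> 4 * h * cmod (cnj c' * x0 + cnj s' * t)"
    "c' * t - s' * x0 = 0"
    by (rule givens_approx)
  have S: "0 \<le> S" using assms(1) by (rule bounded_nonneg)
  have hS: "0 \<le> h * S" "0 \<le> S * h" using S h_nonneg by simp_all
  have hh: "h * (h * S) \<le> 1 / 1000 * (h * S)" using h_small hS(1) by (intro mult_right_mono)
  let ?G = "(Suc i, c, s)" and ?H = "(i, c', s')"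
  let ?Q = "rotmat n ?G * rotmat n ?H"
  have rp: "rotprod n [?G, ?H] = ?Q"
    by (simp add: right_mult_one_mat[of _ n n])
  let ?A = "gmat n g"
  let ?W = "adj (rotmat n ?G) * ?A"
  let ?Y = "adj (rotmat n ?H) * ?W"
  let ?X = "adj ?Q * ?A * ?Q"
  have u: "unit_rot n ?G" "unit_rot n ?H" using r r' assms by auto
  note U = rotmat_unitary[OF u(1)] rotmat_unitary[OF u(2)]
  have UQ: "unitary n ?Q" using U by (rule unitary_mult)
  have C: "?W \<in> carrier_mat n n" "?Y \<in> carrier_mat n n" "?Y * rotmat n ?G \<in> carrier_mat n n"
    by (auto intro!: mult_carrier_mat[of _ n n])
  have "adj ?Q * ?A = ?Y"
    by (simp add: adj_mult[of _ n n _ n] assoc_mult_mat[of _ n n _ n _ n])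
  hence X_eq: "?X = ?Y * rotmat n ?G * rotmat n ?H"
    using assoc_mult_mat[OF C(2) rotmat_carrier rotmat_carrier] by simp
  have fro_A: "fro ?A \<le> 2 * S" using assms(1) by (simp add: bounded_def)
  have fro_W: "fro ?W = fro ?A"
    using U by (simp add: fro_unitary_left[where n = n and m = n] unitary_adj)
  have fro_Y: "fro ?Y = fro ?A"
    using U C fro_W by (simp add: fro_unitary_left[where n = n and m = n] unitary_adj)
  have W: "?W $$ (l, j) = (if l = Suc i then \<rho> else if l = Suc (Suc i) then 0 else lower g l j)"
    if "l < n" "j \<le> l" for l
    using that j assms r(4)
    by (subst rotmat_left[of _ n n]) (auto simp: gmat_lower x1_def x2_def \<rho>_def)
  have X: "?X $$ (l, j) = ?Y $$ (l, j)" if "l < n" for l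
    unfolding X_eq using j that assms by (simp add: rotmat_right[of _ n n] C)
  have Y: "?Y $$ (l, j) = (if l = i then cnj c' * x0 + cnj s' * \<rho> else if l = Suc i then c' * \<rho> - s' * x0
      else if l = Suc (Suc i) then 0 else lower g l j)" if "l < n" "j \<le> l" for l
    using that j assms W by (subst rotmat_left[OF C(1)]) (auto simp: x0_def)
  have "cmod \<rho> \<le> 2 * S"
    using fro_entry[OF C(1), of "Suc i" j] W[of "Suc i"] fro_W fro_A j assms by auto
  hence t: "cmod (t - \<rho>) \<le> 8 * h * S"
    using r(3)[folded \<rho>_def t_def] mult_left_mono[of "cmod \<rho>" "2 * S" "4 * h"] h_nonneg by linarith
  have le: "cmod c' \<le> 1" "cmod s' \<le> 1" using unit_rot_le[OF u(2)] by auto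
  \<comment> \<open>The second rotation annihilates exactly for \<open>t\<close>; replacing
    \<open>t\<close> by \<open>\<rho>\<close> leaves only their difference.\<close>
  have "c' * \<rho> - s' * x0 = - (c' * (t - \<rho>))" using r'(4) by (simp add: algebra_simps)
  hence "cmod (c' * \<rho> - s' * x0) \<le> 1 * (8 * h * S)"
    using mult_mono[OF le(1) t] by (simp add: norm_mult)
  hence e1: "cmod (0 - ?X $$ (Suc i, j)) \<le> 25600 * h * S"
    using X[of "Suc i"] Y[of "Suc i"] j assms hS by (simp add: norm_minus_commute[of "s' * x0"])
  have "cnj c' * x0 + cnj s' * t - ?X $$ (i, j) = cnj s' * (t - \<rho>)"
    using X[of i] Y[of i] j assms by (simp add: algebra_simps)
  hence e2: "cmod (cnj c' * x0 + cnj s' * t - ?X $$ (i, j)) \<le> 8 * h * S"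
    using mult_mono[OF le(2) t] by (simp add: norm_mult)
  have "cmod (?X $$ (i, j)) \<le> 2 * S"
    using fro_entry[OF C(2), of i j] X[of i] fro_Y fro_A j assms by auto
  hence "cmod (cnj c' * x0 + cnj s' * t) \<le> 8 * h * S + 2 * S"
    using e2 norm_triangle_sub[of "cnj c' * x0 + cnj s' * t" "?X $$ (i, j)"] by linarith
  hence "cmod (givens_norm fl x0 t - (cnj c' * x0 + cnj s' * t)) \<le> 4 * h * (8 * h * S + 2 * S)"
    using r'(3) mult_left_mono[of _ _ "4 * h"] h_nonneg by fastforce
  hence "cmod (givens_norm fl x0 t - (cnj c' * x0 + cnj s' * t)) \<le> 9 * h * S"
    using hh hS by (simp add: algebra_simps)
  from norm_diff_triangle_le[OF this e2]
  have e0: "cmod (givens3_norm fl x0 x1 x2 - ?X $$ (i, j)) \<le> 25600 * h * S"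
    using hS unfolding givens3_norm_def t_def[symmetric] by linarith
  have e3: "cmod (0 - ?X $$ (Suc (Suc i), j)) \<le> 25600 * h * S"
    using X[of "Suc (Suc i)"] Y[of "Suc (Suc i)"] j assms hS by simp
  define g' where "g' = double_chase fl i g"
  let ?g = "similarity fl (givens3 fl i x0 x1 x2) g"
  have g': "g' = set_lower (\<lambda>k l. if l = j \<and> k = i then givens3_norm fl x0 x1 x2
      else if l = j \<and> (k = Suc i \<or> k = Suc (Suc i)) then 0 else lower ?g k l) ?g"
    by (simp only: g'_def double_chase_def Let_def j_def x0_def x1_def x2_def
        One_nat_def numeral_2_eq_2 add_Suc_right add_0_right)
  have "list_all2 (near_rot h) (givens3 fl i x0 x1 x2) [?G, ?H]" "\<forall>G\<in>set [?G, ?H]. unit_rot n G"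
      "length (givens3 fl i x0 x1 x2) \<le> 2" using r r' u by (auto simp: givens3_def t_def)
  note sn = similarity_near[OF assms(1) this, unfolded rp]
  have "step n E S g g'"
  proof (rule stepI[of n ?Q "25600 * h"])
    show "cmod (lower g' l m - ?X $$ (l, m)) \<le> 25600 * h * S" if "l < n" "m \<le> l" for l m
      using sn(1)[OF that] e0 e1 e3 unfolding g' lower_set_lower[OF that(2)] by auto
  qed (use UQ S h_nonneg sn(2,3) assms in \<open>auto simp: g'\<close>)
  thus ?thesis by (simp add: g'_def)
qed

end

section \<open>Accumulation of errors\<close>

text \<open>The defect \<open>F - F\<^sup>*\<close> of \<open>F = M - U V\<^sup>*\<close>; for the matrix of a list of generators it
  is diagonal.\<close>
definition skew :: "complex mat \<Rightarrow> complex mat \<Rightarrow> complex mat \<Rightarrow> complex mat" where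
  "skew M U V = (M - U * adj V) - adj (M - U * adj V)"

lemma carrier_prod [simp]:
  "A \<in> carrier_mat n m \<Longrightarrow> B \<in> carrier_mat m k \<Longrightarrow> A * B \<in> carrier_mat n k"
  by (rule mult_carrier_mat)

lemma similar_minus:
  assumes "Q \<in> carrier_mat n n" "A \<in> carrier_mat n n" "B \<in> carrier_mat n n"
  shows "adj Q * (A - B) * Q = adj Q * A * Q - adj Q * B * Q"
proof -
  have "adj Q * (A - B) = adj Q * A - adj Q * B"
    using assms by (intro mult_minus_distrib_mat[of _ n n _ n]) auto
  also have "\<dots> * Q = adj Q * A * Q - adj Q * B * Q"
    using assms by (intro minus_mult_distrib_mat[of _ n n _ _ n]) auto
  finally show ?thesis .
qed

lemma similar_comp:
  assumes "Q \<in> carrier_mat n n" "R \<in> carrier_mat n n" "A \<in> carrier_mat n n"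
  shows "adj (Q * R) * A * (Q * R) = adj R * (adj Q * A * Q) * R"
proof -
  have "adj (Q * R) * A * (Q * R) = adj R * (adj Q * (A * (Q * R)))"
    using assms by (simp add: adj_mult[of _ n n _ n] assoc_mult_mat[of _ n n _ n _ n])
  also have "\<dots> = adj R * (adj Q * (A * Q * R))"
    using assms by (simp add: assoc_mult_mat[of A n n Q n R n])
  also have "\<dots> = adj R * (adj Q * (A * Q) * R)"
    using assms by (simp add: assoc_mult_mat[of "adj Q" n n "A * Q" n R n])
  also have "\<dots> = adj R * (adj Q * A * Q) * R"
    using assms by (simp add: assoc_mult_mat[of "adj Q" n n A n Q n]
        assoc_mult_mat[of "adj R" n n "adj Q * (A * Q)" n R n])
  finally show ?thesis .
qed

lemma similar_adj:
  assumes "Q \<in> carrier_mat n n" "A \<in> carrier_mat n n"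
  shows "adj (adj Q * A * Q) = adj Q * adj A * Q"
proof -
  have "adj (adj Q * A * Q) = adj Q * adj (adj Q * A)"
    using assms by (intro adj_mult[of _ n n _ n]) auto
  also have "adj (adj Q * A) = adj A * Q"
    using assms by (subst adj_mult[of _ n n _ n]) auto
  also have "adj Q * (adj A * Q) = adj Q * adj A * Q"
    using assms by (intro assoc_mult_mat[of _ n n _ n _ n, symmetric]) auto
  finally show ?thesis .
qed

text \<open>Rotating \<open>U\<close> and \<open>V\<close> along conjugates the rank-one term as
  well, and conjugation commutes with taking adjoints.\<close>

lemma skew_similar:
  assumes Q: "Q \<in> carrier_mat n n" and M: "M \<in> carrier_mat n n"
    and U: "U \<in> carrier_mat n 1" and V: "V \<in> carrier_mat n 1"
  shows "skew (adj Q * M * Q) (adj Q * U) (adj Q * V) = adj Q * skew M U V * Q"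
proof -
  have C: "U * adj V \<in> carrier_mat n n" "M - U * adj V \<in> carrier_mat n n"
    using M U V by (auto intro!: mult_carrier_mat[of U n 1] minus_carrier_mat)
  have "adj Q * U * adj (adj Q * V) = adj Q * U * (adj V * Q)"
    using Q V by (simp add: adj_mult[of _ n n _ 1])
  also have "\<dots> = adj Q * U * adj V * Q"
    using Q U V by (intro assoc_mult_mat[of _ n 1 _ n _ n, symmetric]) auto
  also have "adj Q * U * adj V = adj Q * (U * adj V)"
    using Q U V by (intro assoc_mult_mat[of _ n n _ 1 _ n]) auto
  finally have "adj Q * M * Q - adj Q * U * adj (adj Q * V) = adj Q * (M - U * adj V) * Q"
    using similar_minus[OF Q M C(1)] by simp
  hence "skew (adj Q * M * Q) (adj Q * U) (adj Q * V)
      = adj Q * (M - U * adj V) * Q - adj (adj Q * (M - U * adj V) * Q)"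
    by (simp add: skew_def)
  also have "\<dots> = adj Q * skew M U V * Q"
    unfolding skew_def similar_adj[OF Q C(2)]
    using C by (intro similar_minus[OF Q, symmetric]) auto
  finally show ?thesis .
qed

lemma mat_telescope:
  fixes A B C :: "complex mat"
  assumes "A \<in> carrier_mat n m" "B \<in> carrier_mat n m" "C \<in> carrier_mat n m"
  shows "(A - B) + (B - C) = A - C"
  using assms by (intro eq_matI) auto

lemma mat_diff_diff:
  fixes A B C D :: "complex mat"
  assumes "A \<in> carrier_mat n m" "B \<in> carrier_mat n m" "C \<in> carrier_mat n m" "D \<in> carrier_mat n m"
  shows "(A - B) - (C - D) = (A - C) - (B - D)"
  using assms by (intro eq_matI) auto

text \<open>The rank-one difference is split as
  \<open>(U1 - U2) * adj V1 + U2 * adj (V1 - V2)\<close>; the factor 2 accounts for the adjoint in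
  \<open>skew\<close>.\<close>

lemma fro_skew_diff:
  assumes M: "M1 \<in> carrier_mat n n" "M2 \<in> carrier_mat n n"
    and U: "U1 \<in> carrier_mat n 1" "U2 \<in> carrier_mat n 1"
    and V: "V1 \<in> carrier_mat n 1" "V2 \<in> carrier_mat n 1"
  shows "fro (skew M1 U1 V1) \<le> fro (skew M2 U2 V2) +
    2 * (fro (M1 - M2) + (fro (U1 - U2) * fro V1 + fro U2 * fro (V1 - V2)))"
proof -
  have UV: "U * adj V \<in> carrier_mat n n" if "U \<in> carrier_mat n 1" "V \<in> carrier_mat n 1" for U V
    using that by (auto intro!: mult_carrier_mat[of U n 1])
  have mc: "A - B \<in> carrier_mat n n" if "B \<in> carrier_mat n n" for A B :: "complex mat"
    using that by (rule minus_carrier_mat)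
  have mc1: "A - B \<in> carrier_mat n 1" if "B \<in> carrier_mat n 1" for A B :: "complex mat"
    using that by (rule minus_carrier_mat)
  let ?F1 = "M1 - U1 * adj V1" and ?F2 = "M2 - U2 * adj V2"
  let ?D = "?F1 - ?F2"
  let ?W = "(U1 - U2) * adj V1 + U2 * adj (V1 - V2)"
  note C = UV[OF U(1) V(1)] UV[OF U(2) V(2)] UV[OF U(2) V(1)] mc[OF UV[OF U(1) V(1)], of M1]
    mc[OF UV[OF U(2) V(2)], of M2]
  have C': "(U1 - U2) * adj V1 \<in> carrier_mat n n" "U2 * adj (V1 - V2) \<in> carrier_mat n n"
    using UV[OF mc1[OF U(2)] V(1)] UV[OF U(2) mc1[OF V(2)]] by auto
  have D: "?D \<in> carrier_mat n n" by (rule mc[OF C(5)])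
  have "(U1 - U2) * adj V1 = U1 * adj V1 - U2 * adj V1"
    using U V by (intro minus_mult_distrib_mat[of _ n 1 _ _ n]) auto
  moreover have "U2 * adj (V1 - V2) = U2 * adj V1 - U2 * adj V2"
    using U V by (simp only: adj_minus[OF V]) (intro mult_minus_distrib_mat[of _ n 1 _ n], auto)
  ultimately have W: "?W = U1 * adj V1 - U2 * adj V2"
    using mat_telescope[OF C(1,3,2)] by simp
  have "?D = (M1 - M2) - ?W"
    unfolding W using mat_diff_diff[OF M(1) C(1) M(2) C(2)] .
  hence "fro ?D \<le> fro (M1 - M2) + fro ?W"
    using fro_triangle_minus[of "M1 - M2" n n ?W] M C' by (simp add: mc)
  also have "fro ?W \<le> fro ((U1 - U2) * adj V1) + fro (U2 * adj (V1 - V2))"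
    using C' by (rule fro_triangle)
  also have "fro ((U1 - U2) * adj V1) \<le> fro (U1 - U2) * fro (adj V1)"
    using mc1[OF U(2)] V by (intro fro_mult[of _ n 1]) auto
  also have "fro (U2 * adj (V1 - V2)) \<le> fro U2 * fro (adj (V1 - V2))"
    using mc1[OF V(2), of V1] U by (intro fro_mult[of _ n 1]) auto
  finally have fD: "fro ?D \<le> fro (M1 - M2) + (fro (U1 - U2) * fro V1 + fro U2 * fro (V1 - V2))"
    by simp
  have "skew M1 U1 V1 - skew M2 U2 V2 = ?D - adj ?D"
    unfolding skew_def adj_minus[OF C(4,5)] using C
    by (intro mat_diff_diff[of _ n n]) auto
  moreover have "fro (?D - adj ?D) \<le> fro ?D + fro (adj ?D)"
    using D by (intro fro_triangle_minus) auto
  ultimately have "fro (skew M1 U1 V1 - skew M2 U2 V2) \<le> 2 * fro ?D" by simp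
  moreover have "fro (skew M1 U1 V1) \<le> fro (skew M1 U1 V1 - skew M2 U2 V2) + fro (skew M2 U2 V2)"
    using C unfolding skew_def by (intro fro_le_add[of _ n n] mc) auto
  moreover have "a \<le> d + b \<Longrightarrow> d \<le> 2 * f \<Longrightarrow> f \<le> x + (y + z) \<Longrightarrow> a \<le> b + 2 * (x + (y + z))"
    for a b d f x y z :: real by simp
  ultimately show ?thesis using fD by blast
qed

lemma skew_entry:
  assumes "M \<in> carrier_mat n n" "i < n" "j < n"
  shows "skew M (colvec n x) (colvec n y) $$ (i, j) =
    M $$ (i, j) - x i * cnj (y j) - (cnj (M $$ (j, i)) - cnj (x j) * y i)"
  using assms by (simp add: skew_def colvec_def scalar_prod_def)

lemma skew_carrier: "M \<in> carrier_mat n n \<Longrightarrow> skew M (colvec n x) (colvec n y) \<in> carrier_mat n n"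
  unfolding skew_def carrier_mat_def by (simp add: colvec_def)

text \<open>Rebuilding the upper triangle from the lower one changes \<open>M\<close> exactly by the skew part.\<close>
lemma
  assumes M: "M \<in> carrier_mat n n" and low: "\<forall>i<n. \<forall>j\<le>i. lower g i j = M $$ (i, j)"
  shows fro_gmat_diff: "fro (gmat n g - M) \<le> fro (skew M (colvec n (gu g)) (colvec n (gv g)))"
    and fro_skew_gmat: "fro (skew (gmat n g) (colvec n (gu g)) (colvec n (gv g)))
      \<le> fro (skew M (colvec n (gu g)) (colvec n (gv g)))"
proof -
  note C = skew_carrier[OF M, of "gu g" "gv g"] skew_carrier[OF gmat_carrier, of n g "gu g" "gv g"]
  show "fro (gmat n g - M) \<le> fro (skew M (colvec n (gu g)) (colvec n (gv g)))"
  proof (rule fro_mono[OF _ C(1)])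
    show "cmod ((gmat n g - M) $$ (i, j)) \<le> cmod (skew M (colvec n (gu g)) (colvec n (gv g)) $$ (i, j))"
      if "i < n" "j < n" for i j
    proof (cases "j \<le> i")
      case True
      thus ?thesis using that M low by (simp add: gmat_lower)
    next
      case False
      hence "(gmat n g - M) $$ (i, j) = - skew M (colvec n (gu g)) (colvec n (gv g)) $$ (i, j)"
        using that M low by (simp add: gmat_def entry_def skew_entry)
      thus ?thesis by simp
    qed
  qed (use M in \<open>simp add: minus_carrier_mat\<close>)
  show "fro (skew (gmat n g) (colvec n (gu g)) (colvec n (gv g)))
      \<le> fro (skew M (colvec n (gu g)) (colvec n (gv g)))"
  proof (rule fro_mono[OF C(2,1)])
    show "cmod (skew (gmat n g) (colvec n (gu g)) (colvec n (gv g)) $$ (i, j))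
        \<le> cmod (skew M (colvec n (gu g)) (colvec n (gv g)) $$ (i, j))" if "i < n" "j < n" for i j
      \<comment> \<open>Off the diagonal the symmetry formula makes the skew part of
        \<open>gmat n g\<close> vanish; on the diagonal the two skew parts agree.\<close>
      using that M low by (cases i j rule: linorder_cases) (auto simp: skew_entry gmat_def entry_def)
  qed
qed

text \<open>State after \<open>k\<close> steps of error \<open>E\<close>. A step adds at most 12
  units of \<open>E * S\<close> to the skew part. The distance then grows by the current skew part
  and one further unit, whence the square and the constant 13.\<close>

definition tracks :: "nat \<Rightarrow> real \<Rightarrow> real \<Rightarrow> complex mat \<Rightarrow> nat \<Rightarrow> gens \<Rightarrow> bool" where
  "tracks n E S A k g \<longleftrightarrow> (\<exists>Q. unitary n Q \<and>
     fro (gmat n g - adj Q * A * Q) \<le> 13 * real k ^ 2 * E * S \<and>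
     fro (skew (gmat n g) (colvec n (gu g)) (colvec n (gv g))) \<le> 12 * real k * E * S \<and>
     fro (colvec n (gu g)) \<le> 1 + real k * E \<and> fro (colvec n (gv g)) \<le> S * (1 + real k * E))"

text \<open>The threshold limits the distance from a conjugate of \<open>A\<close> to
  \<open>S\<close>, and, as \<open>k \<le> k^2\<close>, also the growth of \<open>u\<close> and
  \<open>v\<close> to a factor 2.\<close>

lemma tracks_bounded:
  assumes "tracks n E S A k g" "13 * real k ^ 2 * E \<le> 1" "fro A \<le> S" "A \<in> carrier_mat n n" "0 \<le> E"
  shows "bounded n S g"
proof -
  obtain Q where Q: "unitary n Q" "fro (gmat n g - adj Q * A * Q) \<le> 13 * real k ^ 2 * E * S"
    "fro (colvec n (gu g)) \<le> 1 + real k * E" "fro (colvec n (gv g)) \<le> S * (1 + real k * E)"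
    using assms(1) by (auto simp: tracks_def)
  have S: "0 \<le> S" using assms(3) fro_nonneg order_trans by blast
  have "real k * E \<le> real k ^ 2 * E"
    using assms(5) by (intro mult_right_mono) (cases k, auto simp: power2_eq_square)
  hence kE: "real k * E \<le> 1" using assms by (simp add: mult.assoc)
  have "fro (gmat n g) \<le> fro (gmat n g - adj Q * A * Q) + fro (adj Q * A * Q)"
    using assms unitary_carrier[OF Q(1)] by (intro fro_le_add[of _ n n]) auto
  also have "fro (adj Q * A * Q) \<le> S"
    using fro_unitary_similar[OF Q(1) assms(4)] assms(3) by simp
  also have "fro (gmat n g - adj Q * A * Q) \<le> 1 * S"
    using Q(2) mult_right_mono[OF assms(2) S] by simp
  finally have "fro (gmat n g) \<le> 2 * S" by simp
  moreover have "S * (1 + real k * E) \<le> S * 2" using kE S by (intro mult_left_mono) auto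
  ultimately show ?thesis using Q kE by (auto simp: bounded_def)
qed

lemma tracks_step:
  assumes "tracks n E S A k g" "13 * real (Suc k) ^ 2 * E \<le> 1" "fro A \<le> S" "A \<in> carrier_mat n n" "0 \<le> E"
    and "bounded n S g" "step n E S g g'"
  shows "tracks n E S A (Suc k) g'"
proof -
  obtain Q where Q: "unitary n Q" "fro (gmat n g - adj Q * A * Q) \<le> 13 * real k ^ 2 * E * S"
    "fro (skew (gmat n g) (colvec n (gu g)) (colvec n (gv g))) \<le> 12 * real k * E * S"
    "fro (colvec n (gu g)) \<le> 1 + real k * E" "fro (colvec n (gv g)) \<le> S * (1 + real k * E)"
    using assms(1) by (auto simp: tracks_def)
  obtain R M where R: "unitary n R" "M \<in> carrier_mat n n" "\<forall>i<n. \<forall>j\<le>i. lower g' i j = M $$ (i, j)"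
    "fro (M - adj R * gmat n g * R) \<le> E * S"
    "fro (colvec n (gu g') - adj R * colvec n (gu g)) \<le> E"
    "fro (colvec n (gv g') - adj R * colvec n (gv g)) \<le> E * S"
    using assms(7) unfolding step_def by blast
  have S: "0 \<le> S" using assms(3) fro_nonneg order_trans by blast
  have ES: "0 \<le> E * S" using S assms(5) by simp
  have "1 \<le> real (Suc k) ^ 2" by (rule one_le_power) simp
  hence "1 * E \<le> real (Suc k) ^ 2 * E" using assms(5) by (rule mult_right_mono)
  hence E1: "E \<le> 1" using assms(2,5) by linarith
  have RC: "R \<in> carrier_mat n n" and QC: "Q \<in> carrier_mat n n"
    using R(1) Q(1) by (auto dest: unitary_carrier)
  let ?U = "colvec n (gu g)" and ?V = "colvec n (gv g)"
  let ?U' = "colvec n (gu g')" and ?V' = "colvec n (gv g')"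
  have RU: "adj R * colvec n x \<in> carrier_mat n 1" for x
    using RC by (intro mult_carrier_mat[of _ n n]) auto
  have RM: "adj R * gmat n g * R \<in> carrier_mat n n"
    using RC by (intro mult_carrier_mat[of _ n n]) auto
  have norm_RU: "fro (adj R * colvec n x) = fro (colvec n x)" for x
    using R(1) by (intro fro_unitary_left[where n = n and m = 1]) (auto simp: unitary_adj)
  have b: "fro ?U \<le> 2" "fro ?V \<le> 2 * S" using assms(6) by (auto simp: bounded_def)
  have u': "fro ?U' \<le> fro ?U + E"
    using fro_le_add[OF colvec_carrier(1) RU] R(5) norm_RU by (smt (verit))
  have v': "fro ?V' \<le> fro ?V + E * S"
    using fro_le_add[OF colvec_carrier(1) RU] R(6) norm_RU by (smt (verit))
  have "E * S \<le> 1 * S" using E1 S by (rule mult_right_mono)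
  hence v3: "fro ?V' \<le> 3 * S" using v' b by linarith
  \<comment> \<open>With \<open>fro ?V' \<le> 3 * S\<close> and \<open>fro ?U \<le> 2\<close> the
    three errors contribute \<open>E * S\<close>, \<open>3 * E * S\<close> and
    \<open>2 * E * S\<close>; doubling their sum gives the 12 of \<open>tracks\<close>.\<close>
  have "fro (skew M ?U' ?V') \<le> fro (skew (adj R * gmat n g * R) (adj R * ?U) (adj R * ?V)) +
    2 * (fro (M - adj R * gmat n g * R) + (fro (?U' - adj R * ?U) * fro ?V' +
      fro (adj R * ?U) * fro (?V' - adj R * ?V)))"
    using R(2) RM RU by (intro fro_skew_diff) auto
  also have "skew (adj R * gmat n g * R) (adj R * ?U) (adj R * ?V) = adj R * skew (gmat n g) ?U ?V * R"
    using RC by (intro skew_similar) auto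
  also have "fro \<dots> = fro (skew (gmat n g) ?U ?V)"
    by (rule fro_unitary_similar[OF R(1) skew_carrier[OF gmat_carrier]])
  also have "fro (?U' - adj R * ?U) * fro ?V' \<le> E * (3 * S)"
    using R(5) v3 assms(5) by (intro mult_mono) auto
  also have "fro (adj R * ?U) * fro (?V' - adj R * ?V) \<le> 2 * (E * S)"
    using R(6) b norm_RU by (intro mult_mono) auto
  finally have sk: "fro (skew M ?U' ?V') \<le> 12 * real (Suc k) * E * S"
    using Q(3) R(4) by (simp add: algebra_simps)
  have "fro (gmat n g' - adj (Q * R) * A * (Q * R)) \<le> fro (gmat n g' - M) +
      fro (M - adj (Q * R) * A * (Q * R))"
    using R(2) RC QC assms(4) by (intro fro_diff_triangle) auto
  also have "fro (M - adj (Q * R) * A * (Q * R)) \<le> fro (M - adj R * gmat n g * R) +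
      fro (adj R * gmat n g * R - adj (Q * R) * A * (Q * R))"
    using R(2) RC QC assms(4) by (intro fro_diff_triangle) auto
  also have "adj R * gmat n g * R - adj (Q * R) * A * (Q * R) = adj R * (gmat n g - adj Q * A * Q) * R"
    using RC QC assms(4) by (simp add: similar_comp similar_minus)
  also have "fro \<dots> = fro (gmat n g - adj Q * A * Q)"
    using QC assms(4) by (intro fro_unitary_similar[OF R(1)] minus_carrier_mat) auto
  also have "fro (gmat n g' - M) \<le> 12 * real (Suc k) * E * S"
    using fro_gmat_diff[OF R(2,3)] sk by linarith
  finally have "fro (gmat n g' - adj (Q * R) * A * (Q * R))
      \<le> 12 * real (Suc k) * E * S + (E * S + 13 * real k ^ 2 * E * S)"
    using R(4) Q(2) by simp
  \<comment> \<open>The new terms \<open>12 * (k + 1) + 1\<close> do not exceed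
    \<open>13 * (2 * k + 1)\<close>, the increment of \<open>13 * k^2\<close>.\<close>
  also have "\<dots> = (12 * real (Suc k) + 1 + 13 * real k ^ 2) * (E * S)"
    by (simp add: algebra_simps)
  also have "\<dots> \<le> (13 * real (Suc k) ^ 2) * (E * S)"
    using ES by (intro mult_right_mono) (auto simp: power2_eq_square algebra_simps)
  finally have 1: "fro (gmat n g' - adj (Q * R) * A * (Q * R)) \<le> 13 * real (Suc k) ^ 2 * E * S"
    by simp
  have 2: "fro (skew (gmat n g') ?U' ?V') \<le> 12 * real (Suc k) * E * S"
    using fro_skew_gmat[OF R(2,3)] sk by linarith
  have 3: "fro ?U' \<le> 1 + real (Suc k) * E" using u' Q(4) by (simp add: algebra_simps)
  have 4: "fro ?V' \<le> S * (1 + real (Suc k) * E)" using v' Q(5) by (simp add: algebra_simps)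
  show ?thesis unfolding tracks_def
    using unitary_mult[OF Q(1) R(1)] 1 2 3 4 by blast
qed

section \<open>Number of updates\<close>

text \<open>The budget \<open>E\<close> per update covers each of three events: a similarity
  (25600), a deflation (\<open>2 * |theta|\<close>) and the dropping of spike entries (2). The
  factor \<open>n\<close> converts entrywise errors to the Frobenius norm.\<close>

locale qr_error = rounding fl h for fl h +
  fixes n :: nat and E S eps theta :: real and A :: "complex mat"
  assumes n: "0 < n" and A: "A \<in> carrier_mat n n" and fro_A: "fro A \<le> S"
    and eps: "0 \<le> eps" "eps \<le> h" and E: "real n * ((25602 + 2 * \<bar>theta\<bar>) * h) \<le> E"
begin

lemma S_nonneg: "0 \<le> S"
  using fro_A fro_nonneg order_trans by blast

lemma E_bounds: "0 \<le> E" "real n * (25600 * h) \<le> E" "real n * (2 * \<bar>theta\<bar> * eps) \<le> E"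
  "real n * (2 * eps) \<le> E"
proof -
  have a: "0 \<le> \<bar>theta\<bar> * h" "\<bar>theta\<bar> * eps \<le> \<bar>theta\<bar> * h"
    using h_nonneg eps by (auto intro: mult_left_mono)
  have l: "x \<le> (25602 + 2 * \<bar>theta\<bar>) * h \<Longrightarrow> real n * x \<le> E" for x
    using E mult_left_mono[of x _ "real n"] order_trans of_nat_0_le_iff by blast
  have "0 \<le> real n * ((25602 + 2 * \<bar>theta\<bar>) * h)" using h_nonneg by simp
  thus "0 \<le> E" using E by linarith
  have c: "(25602 + 2 * \<bar>theta\<bar>) * h = 25602 * h + 2 * (\<bar>theta\<bar> * h)"
    by (simp add: algebra_simps)
  show "real n * (25600 * h) \<le> E" by (rule l) (use a h_nonneg c in linarith)
  show "real n * (2 * \<bar>theta\<bar> * eps) \<le> E" by (rule l) (use a h_nonneg c in linarith)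
  show "real n * (2 * eps) \<le> E" by (rule l) (use a h_nonneg eps c in linarith)
qed

text \<open>The bound on \<open>k\<close> is a premise here, so that it has to be checked only once, at the end
  of the iteration.\<close>
definition reach :: "nat \<Rightarrow> gens \<Rightarrow> bool" where
  "reach k g \<longleftrightarrow> (13 * real k ^ 2 * E \<le> 1 \<longrightarrow> tracks n E S A k g)"

lemma threshold_mono:
  assumes "k \<le> k'" "13 * real k' ^ 2 * E \<le> 1"
  shows "13 * real k ^ 2 * E \<le> 1"
proof -
  have "13 * real k ^ 2 * E \<le> 13 * real k' ^ 2 * E"
    using assms(1) E_bounds(1) by (intro mult_right_mono mult_left_mono power_mono) auto
  thus ?thesis using assms(2) by simp
qed

lemma reach_bounded: "reach k g \<Longrightarrow> 13 * real k ^ 2 * E \<le> 1 \<Longrightarrow> bounded n S g"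
  using tracks_bounded fro_A A E_bounds(1) by (auto simp: reach_def)

lemma reach_mono:
  assumes "reach k g" "k \<le> k'"
  shows "reach k' g"
  unfolding reach_def
proof
  assume t: "13 * real k' ^ 2 * E \<le> 1"
  have ES: "0 \<le> E * S" using E_bounds(1) S_nonneg by simp
  have "tracks n E S A k g"
    using assms threshold_mono[OF assms(2) t] by (simp add: reach_def)
  moreover have "13 * real k ^ 2 * (E * S) \<le> 13 * real k' ^ 2 * (E * S)"
    using assms ES by (intro mult_right_mono mult_left_mono power_mono) auto
  moreover have "12 * real k * (E * S) \<le> 12 * real k' * (E * S)"
    using assms ES by (intro mult_right_mono) auto
  moreover have kE: "1 + real k * E \<le> 1 + real k' * E"
    using assms E_bounds(1) by (simp add: mult_right_mono)
  moreover have "S * (1 + real k * E) \<le> S * (1 + real k' * E)"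
    using kE S_nonneg by (rule mult_left_mono)
  ultimately show "tracks n E S A k' g"
    unfolding tracks_def mult.assoc[of _ E S] by (meson order_trans)
qed

text \<open>The dropping criterion of aggressive early deflation refers to a subdiagonal entry
  stored before the inner iteration, so the earlier state must be known to be bounded too.\<close>

lemma reach_step2:
  assumes "reach k g" "k \<le> k1" "reach k1 g1"
    and "bounded n S g \<Longrightarrow> bounded n S g1 \<Longrightarrow> step n E S g1 g2"
  shows "reach (Suc k1) g2"
  unfolding reach_def
proof
  assume t: "13 * real (Suc k1) ^ 2 * E \<le> 1"
  have t1: "13 * real k1 ^ 2 * E \<le> 1" by (rule threshold_mono[OF _ t]) simp
  have "bounded n S g" "bounded n S g1"
    using reach_bounded[OF assms(1) threshold_mono[OF assms(2) t1]] reach_bounded[OF assms(3) t1] by auto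
  thus "tracks n E S A (Suc k1) g2"
    using assms(3,4) t t1 fro_A A E_bounds(1) by (intro tracks_step) (auto simp: reach_def)
qed

lemma reach_step:
  "reach k g \<Longrightarrow> (bounded n S g \<Longrightarrow> step n E S g g') \<Longrightarrow> reach (Suc k) g'"
  using reach_step2[of k g k g g'] by auto

text \<open>Quantifying over all bounded states makes this a property of the update alone; hence the
  updates of several sweeps may be interleaved in any order.\<close>

definition stable :: "(gens \<Rightarrow> gens) \<Rightarrow> bool" where
  "stable f \<longleftrightarrow> (\<forall>g. bounded n S g \<longrightarrow> step n E S g (f g))"

lemma reach_fold:
  "\<forall>f\<in>set fs. stable f \<Longrightarrow> reach k g \<Longrightarrow> reach (k + length fs) (fold (\<lambda>f. f) fs g)"
proof (induction fs arbitrary: k g)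
  case (Cons f fs)
  have "reach (Suc k) (f g)"
    using Cons.prems by (intro reach_step[of k g]) (auto simp: stable_def)
  from Cons.IH[OF _ this] show ?case using Cons.prems by simp
qed simp

lemma stable_annihilate: "i < n \<Longrightarrow> Suc j < i \<Longrightarrow> stable (annihilate fl (i, j))"
  using step_annihilate E_bounds(2) by (simp add: stable_def)

lemma stable_sweep:
  assumes "hi < n" "sweepable mode lo hi" "f \<in> set (sweep mode fl (\<sigma>, lo, hi))"
  shows "stable f"
proof (cases mode)
  case Single_Shift
  thus ?thesis using assms
    by (auto simp: single_chase_def stable_def intro!: step_single_start step_annihilate E_bounds(2))
next
  case Double_Shift
  thus ?thesis using assms
    by (auto simp: single_chase_def stable_def
        intro!: step_double_start step_double_chase step_annihilate E_bounds(2))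
qed

lemma length_sweep: "hi < n \<Longrightarrow> sweepable mode lo hi \<Longrightarrow> length (sweep mode fl (\<sigma>, lo, hi)) \<le> n"
  by (cases mode) auto

lemma interleavings_set_length:
  "ys \<in> interleavings xss \<Longrightarrow> set ys = (\<Union>xs\<in>set xss. set xs) \<and> length ys = sum_list (map length xss)"
proof (induction xss arbitrary: ys)
  case (Cons xs xss)
  then obtain zs where zs: "zs \<in> interleavings xss" "ys \<in> shuffles xs zs" by auto
  thus ?case using Cons.IH[OF zs(1)] set_shuffles[OF zs(2)] length_shuffles[OF zs(2)] by simp
qed simp

lemma reach_batch:
  assumes "reach k g" "sweep_batch mode fl a b m g g'" "b < n"
  shows "reach (k + m * n) g'"
proof -
  obtain ss ops where ss: "length ss = m"
    "\<forall>(\<sigma>, lo, hi)\<in>set ss. split_block a b g lo hi \<and> sweepable mode lo hi"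
    "ops \<in> interleavings (map (sweep mode fl) ss)" "g' = fold (\<lambda>f. f) ops g"
    using assms(2) by (auto simp: sweep_batch_def)
  have ok: "hi < n" "sweepable mode lo hi" if "(\<sigma>, lo, hi) \<in> set ss" for \<sigma> lo hi
    using ss(2) that assms(3) by (auto simp: split_block_def)
  note il = interleavings_set_length[OF ss(3)]
  have "stable f" if f: "f \<in> set ops" for f
  proof -
    obtain \<sigma> lo hi where s: "(\<sigma>, lo, hi) \<in> set ss" "f \<in> set (sweep mode fl (\<sigma>, lo, hi))"
    proof -
      obtain x where "x \<in> set ss" "f \<in> set (sweep mode fl x)"
        using f il by auto
      moreover obtain \<sigma> lo hi where "x = (\<sigma>, lo, hi)" by (cases x)
      ultimately show thesis using that by simp
    qed
    show ?thesis using ok[OF s(1)] s(2) by (rule stable_sweep)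
  qed
  hence "reach (k + length ops) g'"
    unfolding ss(4) using assms(1) by (intro reach_fold) auto
  moreover have "length ops \<le> m * n"
  proof -
    have "length ops = sum_list (map (\<lambda>s. length (sweep mode fl s)) ss)"
      using il by (simp add: comp_def)
    also have "\<dots> \<le> sum_list (map (\<lambda>_. n) ss)"
      using ok length_sweep by (intro sum_list_mono) auto
    finally show ?thesis using ss(1) by (simp add: sum_list_triv)
  qed
  ultimately show ?thesis by (elim reach_mono) simp
qed

lemma reach_deflate:
  assumes "reach k g" "deflate theta eps n a b g g'"
  shows "reach (Suc k) g'"
proof (rule reach_step[OF assms(1)])
  assume b: "bounded n S g"
  obtain K where K: "\<forall>k\<in>K. negligible_sub theta eps n g k"
    "g' = g\<lparr>gb := (\<lambda>k. if k \<in> K then 0 else gb g k)\<rparr>"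
    using assms(2) by (auto simp: deflate_def)
  have small: "cmod (gb g k) \<le> 2 * \<bar>theta\<bar> * eps * S" if "k \<in> K" for k
  proof -
    have "cmod (gb g k) \<le> theta * eps * spectral_norm (gmat n g)"
      using K(1) that by (simp add: negligible_sub_def)
    \<comment> \<open>No sign of \<open>theta\<close> is assumed; the factor 2 is the slack in
      \<open>bounded\<close>.\<close>
    also have "\<dots> \<le> \<bar>theta\<bar> * eps * (2 * S)"
    proof (intro mult_mono)
      show "spectral_norm (gmat n g) \<le> 2 * S"
        using spectral_norm_le_fro[of "gmat n g"] b by (simp add: bounded_def)
      show "0 \<le> spectral_norm (gmat n g)" using n by (intro spectral_norm_nonneg[of _ n n]) auto
    qed (use eps in \<open>auto intro: mult_right_mono\<close>)
    finally show ?thesis by simp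
  qed
  have "0 \<le> 2 * \<bar>theta\<bar> * eps * S" using eps S_nonneg by simp
  thus "step n E S g g'"
    using small n S_nonneg eps E_bounds(3)
    by (intro step_perturb[of n "2 * \<bar>theta\<bar> * eps"]) (auto simp: K(2) lower_def)
qed

text \<open>All entries zeroed by one deflation count as a single update, so a batch of
  \<open>m\<close> sweeps costs \<open>m * n + 1\<close>, at most \<open>m * (n + 1)\<close> because
  \<open>m\<close> is positive.\<close>

lemma reach_plain:
  assumes "qr_plain mode theta fl eps n a b s g g'" "b < n" "reach k g"
  shows "reach (k + 1 + s * (n + 1)) g'"
  using assms
proof (induction rule: qr_plain.induct)
  case (start g g')
  thus ?case using reach_deflate by simp
next
  case (sweeps s g g1 m g2 g')
  have "reach (Suc (k + 1 + s * (n + 1) + m * n)) g'"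
    using sweeps by (intro reach_deflate[OF reach_batch]) auto
  moreover have "0 < m" using sweeps by (auto simp: sweep_batch_def)
  ultimately show ?case by (elim reach_mono) (simp add: algebra_simps)
qed

lemma reach_hessenberg_reduction:
  assumes "hessenberg_reduction N fl w m g g'" "m < n" "reach k g"
  shows "reach (k + N) g'"
proof -
  obtain as where as: "length as \<le> N" "\<forall>(i, j)\<in>set as. w < i \<and> i \<le> m \<and> w - 1 \<le> j \<and> j + 1 < i"
    "g' = fold (annihilate fl) as g"
    using assms(1) by (auto simp: hessenberg_reduction_def)
  have "reach (k + length (map (annihilate fl) as)) (fold (\<lambda>f. f) (map (annihilate fl) as) g)"
    using as(2) assms by (intro reach_fold) (auto intro!: stable_annihilate)
  hence "reach (k + length as) g'"
    using as(3) by (simp add: fold_map comp_def)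
  thus ?thesis using as(1) by (elim reach_mono) simp
qed

text \<open>The inner iteration costs \<open>1 + s * (n + 1)\<close> updates, dropping spike entries
  costs one, and the reduction at most \<open>kappa * n\<^sup>2\<close>.\<close>

lemma reach_aed:
  assumes "aed mode kappa theta fl eps n g g'" "reach k g"
  shows "reach (k + 2 + kappa * n * (n + 1) + kappa * n\<^sup>2) g'"
proof -
  obtain lo hi w s m g1 where g1: "split_block 0 (n - 1) g lo hi" "lo < w" "w \<le> hi"
      "qr_plain mode theta fl eps n w hi s g g1" "s \<le> kappa * (hi + 1 - w)" "m \<le> hi" "w - 1 \<le> m"
    and small: "\<forall>i\<in>{m<..hi}. cmod (lower g1 i (w - 1)) \<le>
      eps * min (cmod (gb g (w - 1))) (cmod (gd g1 i))"
    and red: "hessenberg_reduction (kappa * (hi + 1 - w)\<^sup>2) fl w m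
      (set_lower (\<lambda>i j. if j = w - 1 \<and> m < i \<and> i \<le> hi then 0 else lower g1 i j) g1) g'"
    using assms(1) unfolding aed_def by blast
  have hi: "hi < n" using g1(1) n by (auto simp: split_block_def)
  let ?k1 = "k + 1 + s * (n + 1)"
  let ?g2 = "set_lower (\<lambda>i j. if j = w - 1 \<and> m < i \<and> i \<le> hi then 0 else lower g1 i j) g1"
  have r1: "reach ?k1 g1" using g1(4) hi assms(2) by (rule reach_plain)
  have r2: "reach (Suc ?k1) ?g2"
  proof (rule reach_step2[OF assms(2) _ r1])
    assume b: "bounded n S g" "bounded n S g1"
    have "gb g (w - 1) = lower g w (w - 1)" using g1(2) by (cases w) (simp_all add: lower_def)
    hence "cmod (gb g (w - 1)) \<le> 2 * S"
      using lower_le_fro[of w n "w - 1" g] b g1(3) hi by (simp add: bounded_def)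
    hence "eps * min (cmod (gb g (w - 1))) (cmod (gd g1 i)) \<le> eps * (2 * S)" for i
      using eps by (intro mult_left_mono) auto
    hence "cmod (lower g1 i (w - 1)) \<le> 2 * eps * S" if "m < i" "i \<le> hi" for i
      using small that order_trans[of "cmod (lower g1 i (w - 1))" "eps * min (cmod (gb g (w - 1))) (cmod (gd g1 i))" "eps * (2 * S)"]
      by simp
    moreover have "0 \<le> 2 * eps * S" using eps S_nonneg by simp
    ultimately show "step n E S g1 ?g2"
      using n S_nonneg eps E_bounds(4)
      by (intro step_perturb[of n "2 * eps"]) (auto simp: lower_set_lower)
  qed simp
  have "reach (Suc ?k1 + kappa * (hi + 1 - w)\<^sup>2) g'"
    using g1 hi r2 by (intro reach_hessenberg_reduction[OF red]) auto
  moreover have w: "hi + 1 - w \<le> n" using hi by simp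
  have "s * (n + 1) \<le> kappa * n * (n + 1)"
    using order_trans[OF g1(5) mult_le_mono2[OF w]] by (rule mult_le_mono1)
  moreover have "kappa * (hi + 1 - w)\<^sup>2 \<le> kappa * n\<^sup>2"
    using w by (intro mult_le_mono2 power_mono) auto
  ultimately show ?thesis by (elim reach_mono) linarith
qed

text \<open>The charge per counted sweep pays for an ordinary sweep as well as for an aggressive
  early deflation, each including the deflation that follows.\<close>

lemma reach_iteration:
  assumes "qr_iteration mode kappa theta fl eps n s g g'" "reach 0 g"
  shows "reach (1 + s * (4 + n + kappa * n * (n + 1) + kappa * n\<^sup>2)) g'"
  using assms
proof (induction rule: qr_iteration.induct)
  case (start g g')
  thus ?case using reach_deflate[of 0] by simp
next
  case (sweeps s g g1 m g2 g')
  let ?W = "4 + n + kappa * n * (n + 1) + kappa * n\<^sup>2"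
  have r: "reach (Suc (1 + s * ?W + m * n)) g'"
    using sweeps n by (intro reach_deflate[OF reach_batch[OF _ sweeps.hyps(2)] sweeps.hyps(3)]) auto
  have "0 < m" using sweeps by (auto simp: sweep_batch_def)
  moreover have "m * (n + 1) \<le> m * ?W" by (intro mult_le_mono2) simp
  ultimately have "m * (n + 1) \<le> m * ?W" "1 \<le> m" by auto
  hence "Suc (1 + s * ?W + m * n) \<le> 1 + (s + m) * ?W" by (simp add: distrib_right)
  with r show ?case by (rule reach_mono)
next
  case (early s g g1 g2 g')
  let ?W = "4 + n + kappa * n * (n + 1) + kappa * n\<^sup>2"
  have "reach (Suc (1 + s * ?W + 2 + kappa * n * (n + 1) + kappa * n\<^sup>2)) g'"
    using early by (intro reach_deflate[OF reach_aed]) auto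
  thus ?case by (elim reach_mono) (simp add: algebra_simps)
qed

end

section \<open>The generators of the colleague matrix\<close>

lemma colleague_carrier [simp]: "colleague n c \<in> carrier_mat n n"
  by (simp add: colleague_def colleague_F_def)

context rounding
begin

text \<open>The tolerance \<open>3 * h\<close> in the numerator fits the product with the rounded
  square root of 2: \<open>h\<close> for the root and at most \<open>2 * h\<close> for the product.
  The denominator carries a single rounding.\<close>

lemma fdiv_rel:
  assumes "cmod (x' - x) \<le> 3 * h * cmod x" "cmod (y' - y) \<le> h * cmod y" "y \<noteq> 0"
  shows "cmod (fdiv fl x' y' - x / y) \<le> 6 * h * cmod (x / y)"
proof -
  have y: "0 < cmod y" using assms(3) by simp
  have "h * cmod y \<le> 1 / 1000 * cmod y" using h_small by (intro mult_right_mono) auto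
  hence y': "999 / 1000 * cmod y \<le> cmod y'"
    using assms(2) norm_triangle_ineq2[of y "y - y'"] by (simp add: norm_minus_commute)
  hence y'0: "0 < cmod y'" "y' \<noteq> 0" using y by auto
  have "x' / y' - x / y = ((x' - x) * y - x * (y' - y)) / (y * y')"
    using assms(3) y'0 by (simp add: field_simps)
  hence "cmod (x' / y' - x / y) = cmod ((x' - x) * y - x * (y' - y)) / (cmod y * cmod y')"
    by (simp add: norm_divide norm_mult)
  also have "\<dots> \<le> (4 * h * cmod x * cmod y) / (cmod y * (999 / 1000 * cmod y))"
  proof (rule frac_le)
    have "cmod ((x' - x) * y - x * (y' - y)) \<le> cmod (x' - x) * cmod y + cmod x * cmod (y' - y)"
      using norm_triangle_ineq4[of "(x' - x) * y" "x * (y' - y)"] by (simp add: norm_mult)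
    also have "\<dots> \<le> 3 * h * cmod x * cmod y + cmod x * (h * cmod y)"
      using assms by (intro add_mono mult_mono) (auto simp: h_nonneg)
    finally show "cmod ((x' - x) * y - x * (y' - y)) \<le> 4 * h * cmod x * cmod y"
      by (simp add: algebra_simps)
    show "cmod y * (999 / 1000 * cmod y) \<le> cmod y * cmod y'"
      using y' y by (intro mult_left_mono) auto
  qed (use y h_nonneg in auto)
  also have "\<dots> = 4000 / 999 * (h * cmod (x / y))"
    using y by (simp add: norm_divide field_simps)
  finally have 1: "cmod (x' / y' - x / y) \<le> 4000 / 999 * (h * cmod (x / y))" .
  have "h * cmod (x / y) \<le> 1 / 1000 * cmod (x / y)" using h_small by (intro mult_right_mono) auto
  hence "cmod (x' / y') \<le> 1005 / 1000 * cmod (x / y)"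
    using 1 norm_triangle_sub[of "x' / y'" "x / y"] norm_ge_zero[of "x / y"] by linarith
  hence "cmod (fdiv fl x' y' - x' / y') \<le> h * (1005 / 1000 * cmod (x / y))"
    using div_err[OF y'0(2), of x'] mult_left_mono[OF _ h_nonneg] order_trans by blast
  from norm_diff_triangle_le[OF this 1] show ?thesis
    using mult_nonneg_nonneg[OF h_nonneg norm_ge_zero[of "x / y"]] by linarith
qed

lemma fsqrt_rel: "0 \<le> x \<Longrightarrow> \<bar>fsqrt fl x - sqrt x\<bar> \<le> h * sqrt x"
proof -
  assume x: "0 \<le> x"
  then obtain d where d: "\<bar>d\<bar> \<le> h" "fsqrt fl x = sqrt x * (1 + d)" using sqrt_ex by blast
  have "fsqrt fl x - sqrt x = d * sqrt x" by (simp add: d(2) algebra_simps)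
  thus ?thesis using d(1) x by (simp add: abs_mult mult_right_mono)
qed

lemma colleague_v_approx:
  assumes "j < n" "c n \<noteq> 0"
  shows "cmod (gv (colleague_gens fl n c) j - colleague_v n c $ j) \<le> 6 * h * cmod (colleague_v n c $ j)"
proof -
  have y: "cmod (fmul fl 2 (c n) - 2 * c n) \<le> h * cmod (2 * c n)" "2 * c n \<noteq> 0"
    using mul_err[of 2 "c n"] assms by auto
  show ?thesis
  proof (cases "j = n - 1")
    case True
    let ?r = "complex_of_real (fsqrt fl 2)" and ?q = "complex_of_real (sqrt 2)"
    have "cmod (?r - ?q) \<le> h * sqrt 2"
      using fsqrt_rel[of 2] by (simp flip: of_real_diff)
    hence "cmod ((?r - ?q) * c 0) \<le> h * sqrt 2 * cmod (c 0)"
      unfolding norm_mult by (rule mult_right_mono) simp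
    hence 1: "cmod (?r * c 0 - ?q * c 0) \<le> h * cmod (?q * c 0)"
      by (simp add: norm_mult left_diff_distrib)
    let ?m = "cmod (?q * c 0)"
    have hm: "h * ?m \<le> 1 / 1000 * ?m" using h_small by (intro mult_right_mono) auto
    have "cmod (?r * c 0) \<le> ?m + h * ?m"
      using 1 norm_triangle_sub[of "?r * c 0" "?q * c 0"] by linarith
    also have "\<dots> \<le> 2 * ?m" using hm norm_ge_zero[of "?q * c 0"] by linarith
    finally have "cmod (fmul fl ?r (c 0) - ?r * c 0) \<le> h * (2 * ?m)"
      using mul_err[of ?r "c 0"] mult_left_mono[OF _ h_nonneg] order_trans by blast
    from norm_diff_triangle_le[OF this 1]
    have "cmod (fmul fl ?r (c 0) - ?q * c 0) \<le> 3 * h * ?m" by simp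
    hence "cmod (- fmul fl ?r (c 0) - - (?q * c 0)) \<le> 3 * h * cmod (- (?q * c 0))"
      by (simp add: norm_minus_commute)
    from fdiv_rel[OF this y]
    have "cmod (cnj (fdiv fl (- fmul fl ?r (c 0)) (fmul fl 2 (c n)) - - (?q * c 0) / (2 * c n)))
        \<le> 6 * h * cmod (cnj (- (?q * c 0) / (2 * c n)))"
      unfolding complex_mod_cnj .
    thus ?thesis using True assms by (simp add: colleague_gens_def Let_def colleague_v_def)
  next
    case False
    hence "j < n - 1" using assms(1) by simp
    have "cmod (- c (n - 1 - j) - - c (n - 1 - j)) \<le> 3 * h * cmod (- c (n - 1 - j))"
      using h_nonneg by simp
    from fdiv_rel[OF this y]
    have "cmod (cnj (fdiv fl (- c (n - 1 - j)) (fmul fl 2 (c n)) - - c (n - 1 - j) / (2 * c n)))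
        \<le> 6 * h * cmod (cnj (- c (n - 1 - j) / (2 * c n)))"
      unfolding complex_mod_cnj .
    thus ?thesis using False \<open>j < n - 1\<close> assms by (simp add: colleague_gens_def Let_def colleague_v_def)
  qed
qed

text \<open>The generators are controlled by the norm of the colleague matrix alone, with no
  separate reference to \<open>F\<close> or \<open>v\<close>. In the first estimate, 12 stems from
  the subdiagonal and 18 from the rounded \<open>v\<close>.\<close>

lemma colleague_gens_approx:
  assumes n: "1 \<le> n" and cn: "c n \<noteq> 0"
  defines "g \<equiv> colleague_gens fl n c" and "\<sigma> \<equiv> spectral_norm (colleague n c)"
  shows "fro (gmat n g - colleague n c) \<le> real n * (30 * h * \<sigma>)"
    and "fro (colvec n (gu g)) \<le> 1"
    and "fro (colvec n (gv g)) \<le> real n * (4 * \<sigma>)"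
    and "fro (skew (gmat n g) (colvec n (gu g)) (colvec n (gv g))) = 0"
proof -
  define \<phi> where "\<phi> j = (if Suc j = n - 1 then complex_of_real (sqrt 2 / 2) else 1 / 2)" for j
  define v where "v j = colleague_v n c $ j" for j
  have \<phi>: "cmod (\<phi> j) \<le> 1" "1 / 2 \<le> cmod (\<phi> j)" for j
    using real_le_rsqrt[of 1 2] real_sqrt_le_iff[of 2 4] by (auto simp: \<phi>_def)
  have col: "colleague n c $$ (i, j) = (if i = Suc j then \<phi> j else if j = Suc i then \<phi> i else 0) +
      (if i = 0 then cnj (v j) else 0)" if "i < n" "j < n" for i j
    using that by (auto simp: colleague_def colleague_F_def colleague_u_def \<phi>_def v_def)
  have gen: "gmat n g $$ (i, j) = (if i = Suc j then gb g j else if j = Suc i then cnj (gb g i) else 0) +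
      (if i = 0 then cnj (gv g j) else 0)" if "i < n" "j < n" for i j
  proof -
    have u: "gu g i = (if i = 0 then 1 else 0)" "gu g j = (if j = 0 then 1 else 0)"
      and l: "lower g a b = (if a = b then if a = 0 then cnj (gv g 0) else 0 else if a = Suc b then gb g b else 0)" for a b
      by (simp_all add: lower_def g_def colleague_gens_def Let_def)
    show ?thesis
    proof (cases i j rule: linorder_cases)
      case less
      thus ?thesis using that u by (simp add: gmat_def entry_def l)
    next
      case equal
      thus ?thesis using that by (simp add: gmat_def entry_def l)
    next
      case greater
      thus ?thesis using that by (simp add: gmat_def entry_def l)
    qed
  qed
  have \<sigma>0: "0 \<le> \<sigma>"
    unfolding \<sigma>_def using n by (intro spectral_norm_nonneg[of _ n n]) auto
  \<comment> \<open>Entry \<open>(1, 0)\<close> lies below the first row, hence outside the rank-one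
    term, and is at least 1/2. For \<open>n = 1\<close> no such entry exists, nor is it needed
    there.\<close>
  have \<sigma>1: "1 \<le> 2 * \<sigma>" if "2 \<le> n"
    using entry_le_spectral_norm[OF colleague_carrier, of 1 n 0 c] col[of 1 0] \<phi>(2)[of 0] that
    by (simp add: \<sigma>_def)
  \<comment> \<open>The first row is the conjugate of \<open>v\<close> plus one entry of modulus at
    most 1, which is bounded by \<open>2 * \<sigma>\<close>.\<close>
  have v: "cmod (v j) \<le> 3 * \<sigma>" if j: "j < n" for j
  proof -
    have "cmod (colleague n c $$ (0, j)) \<le> \<sigma>"
      unfolding \<sigma>_def using n j by (intro entry_le_spectral_norm[of _ n n]) auto
    moreover have "colleague n c $$ (0, j) = (if j = 1 then \<phi> 0 else 0) + cnj (v j)"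
      using col[of 0 j] n j by simp
    moreover have "cmod (if j = 1 then \<phi> 0 else 0) \<le> 2 * \<sigma>"
      using \<phi>(1)[of 0] \<sigma>0 \<sigma>1 j by auto
    moreover have "cmod (cnj (v j)) \<le> cmod ((if j = 1 then \<phi> 0 else 0) + cnj (v j)) +
        cmod (if j = 1 then \<phi> 0 else 0)"
      using norm_triangle_ineq4[of "(if j = 1 then \<phi> 0 else 0) + cnj (v j)" "if j = 1 then \<phi> 0 else 0"]
      by simp
    ultimately show ?thesis by simp
  qed
  have h\<sigma>: "0 \<le> h * \<sigma>" "h * \<sigma> \<le> 1 / 1000 * \<sigma>"
    using h_nonneg mult_right_mono[OF h_small \<sigma>0] \<sigma>0 by auto
  have v': "cmod (gv g j - v j) \<le> 18 * (h * \<sigma>)" if j: "j < n" for j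
  proof -
    have "cmod (gv g j - v j) \<le> 6 * h * cmod (v j)"
      using colleague_v_approx[of j n c] j cn by (simp add: g_def v_def)
    also have "\<dots> \<le> 6 * h * (3 * \<sigma>)" using v[OF j] h_nonneg by (intro mult_left_mono) auto
    finally show ?thesis by simp
  qed
  have b: "cmod (gb g j - \<phi> j) \<le> 12 * (h * \<sigma>)" if j: "Suc j < n" for j
  proof (cases "Suc j = n - 1")
    case True
    have "cmod (complex_of_real (fsqrt fl 2) - complex_of_real (sqrt 2)) \<le> h * sqrt 2"
      using fsqrt_rel[of 2] by (simp flip: of_real_diff)
    also have "\<dots> \<le> 3 * h * cmod (complex_of_real (sqrt 2))" using h_nonneg by simp
    finally have "cmod (fdiv fl (complex_of_real (fsqrt fl 2)) 2 - complex_of_real (sqrt 2) / 2)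
        \<le> 6 * h * cmod (complex_of_real (sqrt 2) / 2)"
      using h_nonneg by (intro fdiv_rel) auto
    hence "cmod (gb g j - \<phi> j) \<le> 6 * h * cmod (\<phi> j)"
      using True by (simp add: g_def colleague_gens_def Let_def \<phi>_def)
    also have "\<dots> \<le> 6 * h * (2 * \<sigma>)"
      using \<phi>(1)[of j] \<sigma>1 j h_nonneg by (intro mult_left_mono) auto
    finally show ?thesis by simp
  next
    case False
    thus ?thesis using h\<sigma> j by (auto simp: g_def colleague_gens_def Let_def \<phi>_def)
  qed
  show "fro (gmat n g - colleague n c) \<le> real n * (30 * h * \<sigma>)"
  proof (rule fro_le_max)
    fix i j assume ij: "i < n" "j < n"
    let ?x = "(if i = Suc j then gb g j - \<phi> j else if j = Suc i then cnj (gb g i - \<phi> i) else 0)"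
    let ?y = "(if i = 0 then cnj (gv g j - v j) else 0)"
    have real: "cnj (\<phi> i) = \<phi> i" by (simp add: \<phi>_def)
    have "(gmat n g - colleague n c) $$ (i, j) = gmat n g $$ (i, j) - colleague n c $$ (i, j)"
      using ij carrier_matD[OF colleague_carrier[of n c]] by simp
    also have "\<dots> = ?x + ?y"
      unfolding col[OF ij] gen[OF ij] using real by auto
    finally have "cmod ((gmat n g - colleague n c) $$ (i, j)) \<le> cmod ?x + cmod ?y"
      by (simp only: norm_triangle_ineq)
    moreover have "cmod ?x \<le> 12 * (h * \<sigma>)"
      using b[of j] b[of i] ij h\<sigma> by (simp only: complex_mod_cnj split: if_split) simp
    moreover have "cmod ?y \<le> 18 * (h * \<sigma>)"
      using v'[of j] ij h\<sigma> by (simp only: complex_mod_cnj split: if_split) simp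
    ultimately show "cmod ((gmat n g - colleague n c) $$ (i, j)) \<le> 30 * h * \<sigma>" by linarith
  qed (use h\<sigma> \<sigma>0 h_nonneg in \<open>auto simp: minus_carrier_mat\<close>)
  have "(\<Sum>i<n. (cmod (gu g i))\<^sup>2) = (\<Sum>i<n. if i = 0 then 1 else 0)"
    by (intro sum.cong) (auto simp: g_def colleague_gens_def Let_def)
  hence "(fro (colvec n (gu g)))\<^sup>2 \<le> 1\<^sup>2"
    by (simp add: fro_sq colvec_def)
  thus "fro (colvec n (gu g)) \<le> 1" by (rule power2_le_imp_le) simp
  show "fro (colvec n (gv g)) \<le> real n * (4 * \<sigma>)"
  proof (rule fro_le_max)
    fix i j :: nat assume ij: "i < n" "j < 1"
    have "cmod (gv g i) \<le> 4 * \<sigma>"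
      using v[OF ij(1)] v'[OF ij(1)] h\<sigma> norm_triangle_sub[of "gv g i" "v i"] \<sigma>0 by linarith
    thus "cmod (colvec n (gv g) $$ (i, j)) \<le> 4 * \<sigma>" using ij by (simp add: colvec_def)
  qed (use n \<sigma>0 in auto)
  \<comment> \<open>The diagonal entry is formed from the same rounded \<open>v\<close> that is
    stored, so the initial skew part vanishes exactly in spite of rounding.\<close>
  have "fro (skew (gmat n g) (colvec n (gu g)) (colvec n (gv g))) \<le> real n * 0"
  proof (rule fro_le_max)
    fix i j assume ij: "i < n" "j < n"
    thus "cmod (skew (gmat n g) (colvec n (gu g)) (colvec n (gv g)) $$ (i, j)) \<le> 0"
      by (cases i j rule: linorder_cases)
        (auto simp: skew_entry gmat_def entry_def lower_def g_def colleague_gens_def Let_def)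
  qed (auto simp: skew_carrier)
  thus "fro (skew (gmat n g) (colvec n (gu g)) (colvec n (gv g))) = 0"
    using fro_nonneg[of "skew (gmat n g) (colvec n (gu g)) (colvec n (gv g))"] by simp
qed

end

section \<open>The backward error bound\<close>

lemma fro_self_minus [simp]: "fro (X - X) = 0"
  by (auto simp: fro_def intro!: L2_set_0')

lemma mat_add_minus:
  fixes A B :: "complex mat"
  assumes "A \<in> carrier_mat n m" "B \<in> carrier_mat n m"
  shows "A + (B - A) = B"
  using assms by (intro eq_matI) auto

text \<open>Conjugating the deviation of \<open>T\<close> back by \<open>Q\<close> turns it into a
  perturbation of \<open>A\<close> of the same Frobenius norm.\<close>

lemma exact_backward_error:
  assumes Q: "unitary n Q" and A: "A \<in> carrier_mat n n" and T: "T \<in> carrier_mat n n"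
  defines "D \<equiv> Q * T * adj Q - A"
  shows "D \<in> carrier_mat n n" "T = adj Q * (A + D) * Q" "fro D = fro (T - adj Q * A * Q)"
proof -
  have QC: "Q \<in> carrier_mat n n" using Q by (rule unitary_carrier)
  have C: "Q * T * adj Q \<in> carrier_mat n n" using QC T by auto
  show D: "D \<in> carrier_mat n n" unfolding D_def using A by (rule minus_carrier_mat)
  have AD: "A + D = Q * T * adj Q"
    unfolding D_def using A C by (rule mat_add_minus)
  have "adj (adj Q * Q) * T * (adj Q * Q) = adj Q * (adj (adj Q) * T * adj Q) * Q"
    using QC T by (intro similar_comp) auto
  hence TT: "adj Q * (Q * T * adj Q) * Q = T"
    using T unitary_left[OF Q] by simp
  thus "T = adj Q * (A + D) * Q" by (simp only: AD)
  have "fro D = fro (adj Q * D * Q)" using fro_unitary_similar[OF Q D] by simp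
  also have "adj Q * D * Q = T - adj Q * A * Q"
    unfolding D_def similar_minus[OF QC C A] TT ..
  finally show "fro D = fro (T - adj Q * A * Q)" .
qed

lemma step_count:
  fixes n s kappa :: nat
  assumes "1 \<le> n" "s \<le> kappa * n"
  shows "1 + s * (4 + n + kappa * n * (n + 1) + kappa * n\<^sup>2) \<le> (1 + 5 * kappa + 3 * kappa\<^sup>2) * n ^ 3"
proof -
  have n2: "n \<le> n\<^sup>2" "1 \<le> n\<^sup>2" "1 \<le> n ^ 3" using assms(1) by (auto simp: power2_eq_square)
  have "4 + n + kappa * n * (n + 1) + kappa * n\<^sup>2 = 4 + n + 2 * (kappa * n\<^sup>2) + kappa * n"
    by (simp add: algebra_simps power2_eq_square)
  moreover have "kappa * n \<le> kappa * n\<^sup>2" using n2(1) by (rule mult_le_mono2)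
  moreover have "(5 + 3 * kappa) * n\<^sup>2 = 5 * n\<^sup>2 + 3 * (kappa * n\<^sup>2)" by (simp add: algebra_simps)
  ultimately have "4 + n + kappa * n * (n + 1) + kappa * n\<^sup>2 \<le> (5 + 3 * kappa) * n\<^sup>2"
    using n2 by linarith
  hence "s * (4 + n + kappa * n * (n + 1) + kappa * n\<^sup>2) \<le> kappa * n * ((5 + 3 * kappa) * n\<^sup>2)"
    using assms(2) by (rule mult_le_mono[rotated])
  also have "\<dots> = (5 * kappa + 3 * kappa\<^sup>2) * n ^ 3"
    by (simp add: algebra_simps power2_eq_square power3_eq_cube)
  finally show ?thesis using n2(3) by (simp add: algebra_simps)
qed

text \<open>Here \<open>m\<close> converts \<open>eps\<close> into \<open>h\<close>,
  \<open>k * n^3\<close> bounds the number of updates, and \<open>r * n * eps\<close> is the budget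
  \<open>E\<close> of one update.\<close>

lemma schur_backward_error:
  fixes n kappa :: nat and mu theta eps :: real
  defines "m \<equiv> max 1 mu" and "k \<equiv> real (1 + 5 * kappa + 3 * kappa\<^sup>2)"
  defines "r \<equiv> (25602 + 2 * \<bar>theta\<bar>) * m"
  defines "C \<equiv> 430 * m + 52 * r * k\<^sup>2"
  assumes n: "1 \<le> n" and cn: "c n \<noteq> 0" and eps: "0 < eps" "C * real n ^ 8 * eps \<le> 1"
    and model: "standard_model mu eps fl"
    and schur: "computed_schur_form mode kappa theta fl eps n c T"
  shows "\<exists>Q. unitary n Q \<and> T \<in> carrier_mat n n \<and>
    fro (T - adj Q * colleague n c * Q) \<le> C * real n ^ 8 * spectral_norm (colleague n c) * eps"
proof -
  obtain s g where g: "s \<le> kappa * n"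
    "qr_iteration mode kappa theta fl eps n s (colleague_gens fl n c) g"
    "T = gmat n g \<or> T = fgmat fl n g"
    using schur by (auto simp: computed_schur_form_def)
  define h where "h = m * eps"
  define \<sigma> where "\<sigma> = spectral_norm (colleague n c)"
  \<comment> \<open>This scale dominates both the initial \<open>v\<close> and the Frobenius norm of
    \<open>A\<close>, which is at most \<open>2 * n * \<sigma>\<close>.\<close>
  define S where "S = real n * (4 * \<sigma>)"
  define E where "E = real n * ((25602 + 2 * \<bar>theta\<bar>) * h)"
  define g0 where "g0 = colleague_gens fl n c"
  define A where "A = gmat n g0"
  let ?L = "colleague n c"
  have m: "1 \<le> m" by (simp add: m_def)
  have k: "1 \<le> k" by (simp add: k_def)
  have r: "25602 * m \<le> r" unfolding r_def using m by (intro mult_right_mono) auto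
  have pow: "real n ^ i \<le> real n ^ 8" if "i \<le> 8" for i
    using that n by (intro power_increasing) auto
  have n8: "1 \<le> real n ^ 8" using pow[of 0] by simp
  have rk: "r \<le> r * k\<^sup>2" using mult_left_mono[of 1 "k\<^sup>2" r] r m k by (simp add: one_le_power)
  have C: "1000 * m \<le> C" using rk r m unfolding C_def by linarith
  \<comment> \<open>As \<open>C\<close> is at least \<open>1000 * m\<close>, the smallness of
    \<open>eps\<close> also yields the bound on \<open>h\<close> required by
    \<open>rounding\<close>.\<close>
  have "1000 * m * eps \<le> C * real n ^ 8 * eps"
    using mult_mono[OF C n8] C m eps by (intro mult_right_mono) auto
  hence h: "h \<le> 1 / 1000" using eps(2) by (simp add: h_def)
  interpret rounding fl h
    unfolding h_def m_def using model eps(1) h by (intro standard_model_rounding) (auto simp: h_def m_def)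
  note init = colleague_gens_approx[OF n, of c, OF cn, folded \<sigma>_def g0_def A_def]
  have \<sigma>: "0 \<le> \<sigma>" unfolding \<sigma>_def using n by (intro spectral_norm_nonneg[of _ n n]) auto
  have AC: "A \<in> carrier_mat n n" by (simp add: A_def)
  have "30 * h * \<sigma> \<le> 1 * \<sigma>" using h \<sigma> by (intro mult_right_mono) auto
  hence "real n * (30 * h * \<sigma>) \<le> real n * \<sigma>" by (intro mult_left_mono) auto
  moreover have "fro ?L \<le> real n * \<sigma>"
    unfolding \<sigma>_def using n by (intro fro_le_spectral_norm) auto
  moreover have "fro A \<le> fro (A - ?L) + fro ?L" using AC by (intro fro_le_add[of _ n n]) auto
  moreover have "0 \<le> real n * \<sigma>" using \<sigma> by simp
  ultimately have fA: "fro A \<le> S" using init(1) by (simp add: S_def)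
  have "eps \<le> h" using m eps by (simp add: h_def)
  then interpret q: qr_error fl h n E S eps theta A
    using n AC fA eps by unfold_locales (auto simp: E_def)
  have "tracks n E S A 0 g0"
    unfolding tracks_def using init unitary_one[of n] AC
    by (intro exI[of _ "1\<^sub>m n"]) (simp add: A_def S_def left_mult_one_mat[OF gmat_carrier] right_mult_one_mat[OF gmat_carrier])
  hence "q.reach 0 g0" by (simp add: q.reach_def)
  hence reach: "q.reach ((1 + 5 * kappa + 3 * kappa\<^sup>2) * n ^ 3) g"
    using q.reach_mono[OF q.reach_iteration[OF g(2)] step_count[OF n g(1)]] by (simp add: g0_def)
  have K: "real ((1 + 5 * kappa + 3 * kappa\<^sup>2) * n ^ 3) = k * real n ^ 3"
    by (simp only: k_def of_nat_mult of_nat_power)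
  have KE: "13 * (k * real n ^ 3)\<^sup>2 * E = 13 * r * k\<^sup>2 * eps * real n ^ 7"
    by (simp add: E_def h_def r_def power_mult_distrib algebra_simps eval_nat_numeral)
  have "13 * r * k\<^sup>2 * eps * real n ^ 7 \<le> C * eps * real n ^ 8"
    using pow[of 7] r m k eps by (intro mult_mono) (auto simp: C_def)
  hence "13 * (k * real n ^ 3)\<^sup>2 * E \<le> 1" using KE eps(2) by (simp add: ac_simps)
  hence thr: "13 * (real ((1 + 5 * kappa + 3 * kappa\<^sup>2) * n ^ 3))\<^sup>2 * E \<le> 1" unfolding K .
  have bounded: "bounded n S g" using reach thr by (rule q.reach_bounded)
  obtain Q where Q: "unitary n Q" "fro (gmat n g - adj Q * A * Q) \<le> 13 * (k * real n ^ 3)\<^sup>2 * E * S"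
    using reach thr unfolding q.reach_def tracks_def K by blast
  have QC: "Q \<in> carrier_mat n n" using Q(1) by (rule unitary_carrier)
  have TC: "T \<in> carrier_mat n n" using g(3) by (auto simp: fgmat_def)
  have "fro (T - gmat n g) \<le> real n * (100 * h * S)"
  proof (cases "T = gmat n g")
    case True
    thus ?thesis using h_nonneg q.S_nonneg by simp
  next
    case False
    hence "T = fgmat fl n g" using g(3) by simp
    thus ?thesis using fentry_near[OF bounded] h_nonneg q.S_nonneg
      by (intro fro_le_max[of _ n n]) (auto simp: near_def fgmat_def minus_carrier_mat carrier_matD[OF gmat_carrier])
  qed
  moreover have "fro (T - adj Q * ?L * Q) \<le> fro (T - gmat n g) + fro (gmat n g - adj Q * ?L * Q)"
    using TC QC by (intro fro_diff_triangle[of _ n n]) auto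
  moreover have "fro (gmat n g - adj Q * ?L * Q) \<le> fro (gmat n g - adj Q * A * Q) +
      fro (adj Q * A * Q - adj Q * ?L * Q)"
    using AC QC by (intro fro_diff_triangle[of _ n n]) auto
  moreover have "fro (adj Q * A * Q - adj Q * ?L * Q) = fro (A - ?L)"
    using fro_unitary_similar[OF Q(1), of "A - ?L"]
    by (simp only: similar_minus[OF QC AC colleague_carrier] minus_carrier_mat[OF colleague_carrier])
  ultimately have "fro (T - adj Q * ?L * Q) \<le> real n * (100 * h * S) +
      (13 * r * k\<^sup>2 * eps * real n ^ 7 * S + real n * (30 * h * \<sigma>))"
    using Q(2) init(1) unfolding KE by linarith
  \<comment> \<open>The summands stem from evaluating the upper triangle of \<open>T\<close> in
    floating point, from the rounded initial generators, and from the accumulated updates, where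
    \<open>52 = 13 * 4\<close> and the powers of \<open>n\<close> are 6 from the squared number of
    updates and 1 each from \<open>E\<close> and \<open>S\<close>.\<close>
  also have "\<dots> = (400 * m * real n ^ 2 + 30 * m * real n ^ 1 + 52 * r * k\<^sup>2 * real n ^ 8) * (\<sigma> * eps)"
    by (simp add: S_def h_def algebra_simps eval_nat_numeral)
  also have "\<dots> \<le> (400 * m * real n ^ 8 + 30 * m * real n ^ 8 + 52 * r * k\<^sup>2 * real n ^ 8) * (\<sigma> * eps)"
    using pow[of 2] pow[of 1] m \<sigma> eps by (intro mult_right_mono add_mono mult_left_mono) auto
  also have "\<dots> = C * real n ^ 8 * \<sigma> * eps"
    by (simp add: C_def algebra_simps)
  finally show ?thesis using Q(1) TC unfolding \<sigma>_def by blast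
qed

theorem theorem3p2:
  fixes kappa :: nat and mu theta :: real
  shows "\<exists>P :: real poly. degree P \<le> 10 \<and>
    (\<forall>(n::nat) (p::complex poly) (c::nat \<Rightarrow> complex) (eps::real) (fl::fp)
       (mode::shift_mode) (T::complex mat).
       1 \<le> n \<longrightarrow> p = (\<Sum>i\<le>n. smult (c i) (cheb_poly i)) \<longrightarrow> c n \<noteq> 0 \<longrightarrow>
       (mode = Double_Shift \<longrightarrow> (\<forall>i\<le>n. c i \<in> \<real>)) \<longrightarrow>
       0 < eps \<longrightarrow> poly P (real n) * eps \<le> 1 \<longrightarrow> standard_model mu eps fl \<longrightarrow>
       computed_schur_form mode kappa theta fl eps n c T \<longrightarrow>
       (\<exists>Q \<delta>A. unitary n Q \<and> \<delta>A \<in> carrier_mat n n \<and>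
          T = mat_adjoint Q * (colleague n c + \<delta>A) * Q \<and>
          spectral_norm \<delta>A \<le> poly P (real n) * spectral_norm (colleague n c) * eps))"
proof -
  define C where "C = 430 * max 1 mu + 52 * ((25602 + 2 * \<bar>theta\<bar>) * max 1 mu) *
    (real (1 + 5 * kappa + 3 * kappa\<^sup>2))\<^sup>2"
  have "degree (monom C 8) \<le> 10"
    using degree_monom_le[of C 8] by simp
  moreover have "\<exists>Q \<delta>A. unitary n Q \<and> \<delta>A \<in> carrier_mat n n \<and>
      T = mat_adjoint Q * (colleague n c + \<delta>A) * Q \<and>
      spectral_norm \<delta>A \<le> poly (monom C 8) (real n) * spectral_norm (colleague n c) * eps"
    if asm: "1 \<le> n" "c n \<noteq> 0" "0 < eps" "poly (monom C 8) (real n) * eps \<le> 1"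
      "standard_model mu eps fl" "computed_schur_form mode kappa theta fl eps n c T"
    for n c eps fl mode T
  proof -
    have "C * real n ^ 8 * eps \<le> 1" using asm(4) by (simp add: poly_monom)
    then obtain Q where Q: "unitary n Q" "T \<in> carrier_mat n n"
      "fro (T - adj Q * colleague n c * Q) \<le> C * real n ^ 8 * spectral_norm (colleague n c) * eps"
      using schur_backward_error[of n c eps mu theta kappa fl mode T] asm unfolding C_def by blast
    let ?D = "Q * T * adj Q - colleague n c"
    note D = exact_backward_error[OF Q(1) colleague_carrier Q(2)]
    have "spectral_norm ?D \<le> C * real n ^ 8 * spectral_norm (colleague n c) * eps"
      using spectral_norm_le_fro[of ?D] D(3)[of c] Q(3) by simp
    thus ?thesis using Q(1) D(1,2)[of c] by (auto simp: poly_monom)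
  qed
  ultimately show ?thesis by blast
qed

end
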